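(* Let $p=\frac12$ and let $\alpha,\beta,\gamma,\delta\ge 0$ with $\max(\alpha,\beta,\gamma,\delta)>0$. There exists a constant $C=C(\alpha,\beta,\gamma,\delta)$ such that for all $\varepsilon\in(0,1)$ the $\varepsilon$-mixing time of the simple exclusion process with open boundaries with parameters $(\frac12,\alpha,\beta,\gamma,\delta)$ satisfies $$\frac{1}{\pi^2}\le \liminf_{N\to\infty}\frac{t^N_{\mathrm{mix}}(\varepsilon)}{N^2\log N}\le \limsup_{N\to\infty}\frac{t^N_{\mathrm{mix}}(\varepsilon)}{N^2\log N}\le C .$$
   Context: For $N\in\mathbb{N}$ let $[N]=\{1,\dots,N\}$ and $\Omega_N=\{0,1\}^N$; site $x$ is occupied by a particle in $\eta\in\Omega_N$ if $\eta(x)=1$ and empty if $\eta(x)=0$. The simple exclusion process with open boundaries with parameters $(p,\alpha,\beta,\gamma,\delta)$, $p\in[0,1]$, $\alpha,\beta,\gamma,\delta\ge0$, is the continuous-time Markov chain $(\eta_t)_{t\ge0}$ on $\Omega_N$ with generator $$\mathcal{L}f(\eta)=\sum_{x=1}^{N-1}p\,\eta(x)(1-\eta(x+1))[f(\eta^{x,x+1})-f(\eta)]+\sum_{x=2}^{N}(1-p)\,\eta(x)(1-\eta(x-1))[f(\eta^{x,x-1})-f(\eta)]$$ $$\qquad+\big(\alpha(1-\eta(1))+\gamma\eta(1)\big)[f(\eta^1)-f(\eta)]+\big(\delta(1-\eta(N))+\beta\eta(N)\big)[f(\eta^N)-f(\eta)],$$ where $\eta^{x,y}$ is $\eta$ with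 the values at $x,y$ exchanged and $\eta^x$ is $\eta$ with the value at $x$ flipped. The boundary parameters do not depend on $N$. Parameters are such that there is a unique stationary distribution $\mu$ (depending on $N$; possibly a Dirac measure). The $\varepsilon$-mixing time is $$t^N_{\mathrm{mix}}(\varepsilon)=\inf\Big\{t\ge0:\max_{\eta\in\Omega_N}\|\mathbb{P}(\eta_t\in\cdot\mid\eta_0=\eta)-\mu\|_{\mathrm{TV}}<\varepsilon\Big\},\qquad \|\mu-\nu\|_{\mathrm{TV}}=\tfrac12\sum_{x\in\Omega_N}|\mu(x)-\nu(x)|.$$ *)

theory Defs
  imports "HOL-Probability.Probability"
begin

type_synonym config = "nat \<Rightarrow> nat"

definition Omega :: "nat \<Rightarrow> config set" where
  "Omega N = {1..N} \<rightarrow>\<^sub>E {0, 1}"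

definition exchange :: "nat \<Rightarrow> nat \<Rightarrow> config \<Rightarrow> config" where
  "exchange x y \<eta> = \<eta>(x := \<eta> y, y := \<eta> x)"

definition flip :: "nat \<Rightarrow> config \<Rightarrow> config" where
  "flip x \<eta> = \<eta>(x := 1 - \<eta> x)"

definition sep_generator ::
  "real \<Rightarrow> real \<Rightarrow> real \<Rightarrow> real \<Rightarrow> real \<Rightarrow> nat \<Rightarrow> (config \<Rightarrow> real) \<Rightarrow> config \<Rightarrow> real" where
  "sep_generator p \<alpha> \<beta> \<gamma> \<delta> N f \<eta> =
     (\<Sum>x = 1..N - 1. p * real (\<eta> x) * (1 - real (\<eta> (x + 1))) * (f (exchange x (x + 1) \<eta>) - f \<eta>))
   + (\<Sum>x = 2..N. (1 - p) * real (\<eta> x) * (1 - real (\<eta> (x - 1))) * (f (exchange x (x - 1) \<eta>) - f \<eta>))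
   + (\<alpha> * (1 - real (\<eta> 1)) + \<gamma> * real (\<eta> 1)) * (f (flip 1 \<eta>) - f \<eta>)
   + (\<delta> * (1 - real (\<eta> N)) + \<beta> * real (\<eta> N)) * (f (flip N \<eta>) - f \<eta>)"

text \<open>The Markov semigroup of the continuous-time chain on the finite state space \<^term>\<open>Omega N\<close>
  is the operator exponential of \<open>t\<close> times the generator, given by its power series; on \<^term>\<open>Omega N\<close>
  this series converges absolutely (see \<open>sep_semigroup_summable\<close> below).\<close>

definition sep_semigroup ::
  "real \<Rightarrow> real \<Rightarrow> real \<Rightarrow> real \<Rightarrow> real \<Rightarrow> nat \<Rightarrow> real \<Rightarrow> (config \<Rightarrow> real) \<Rightarrow> config \<Rightarrow> real" where
  "sep_semigroup p \<alpha> \<beta> \<gamma> \<delta> N t f \<eta> =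
     (\<Sum>k. t ^ k / fact k * ((sep_generator p \<alpha> \<beta> \<gamma> \<delta> N ^^ k) f) \<eta>)"

text \<open>\<open>sep_transition p \<alpha> \<beta> \<gamma> \<delta> N t \<eta> \<xi>\<close> is the probability that the chain started
  from \<open>\<eta>\<close> is in state \<open>\<xi>\<close> at time \<open>t\<close>.\<close>

definition sep_transition ::
  "real \<Rightarrow> real \<Rightarrow> real \<Rightarrow> real \<Rightarrow> real \<Rightarrow> nat \<Rightarrow> real \<Rightarrow> config \<Rightarrow> config \<Rightarrow> real" where
  "sep_transition p \<alpha> \<beta> \<gamma> \<delta> N t \<eta> \<xi> = sep_semigroup p \<alpha> \<beta> \<gamma> \<delta> N t (indicator {\<xi>}) \<eta>"

definition sep_stationary ::
  "real \<Rightarrow> real \<Rightarrow> real \<Rightarrow> real \<Rightarrow> real \<Rightarrow> nat \<Rightarrow> config pmf \<Rightarrow> bool" where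
  "sep_stationary p \<alpha> \<beta> \<gamma> \<delta> N \<mu> \<longleftrightarrow>
     set_pmf \<mu> \<subseteq> Omega N \<and>
     (\<forall>t\<ge>0. \<forall>\<xi>\<in>Omega N. (\<Sum>\<eta>\<in>Omega N. pmf \<mu> \<eta> * sep_transition p \<alpha> \<beta> \<gamma> \<delta> N t \<eta> \<xi>) = pmf \<mu> \<xi>)"

text \<open>Meaningful only for parameters with exactly one stationary distribution.\<close>

definition sep_mu :: "real \<Rightarrow> real \<Rightarrow> real \<Rightarrow> real \<Rightarrow> real \<Rightarrow> nat \<Rightarrow> config pmf" where
  "sep_mu p \<alpha> \<beta> \<gamma> \<delta> N = (THE \<mu>. sep_stationary p \<alpha> \<beta> \<gamma> \<delta> N \<mu>)"

definition tv_dist :: "nat \<Rightarrow> (config \<Rightarrow> real) \<Rightarrow> (config \<Rightarrow> real) \<Rightarrow> real" where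
  "tv_dist N \<mu> \<nu> = 1 / 2 * (\<Sum>x\<in>Omega N. \<bar>\<mu> x - \<nu> x\<bar>)"

text \<open>The infimum is taken in the extended reals, so that it is infinite for the empty set.\<close>

definition sep_tmix ::
  "real \<Rightarrow> real \<Rightarrow> real \<Rightarrow> real \<Rightarrow> real \<Rightarrow> nat \<Rightarrow> real \<Rightarrow> ereal" where
  "sep_tmix p \<alpha> \<beta> \<gamma> \<delta> N \<epsilon> =
     Inf (ereal ` {t. 0 \<le> t \<and>
       Max ((\<lambda>\<eta>. tv_dist N (sep_transition p \<alpha> \<beta> \<gamma> \<delta> N t \<eta>) (pmf (sep_mu p \<alpha> \<beta> \<gamma> \<delta> N))) ` Omega N)
         < \<epsilon>})"

lemma exchange_in_Omega:
  "\<eta> \<in> Omega N \<Longrightarrow> x \<in> {1..N} \<Longrightarrow> y \<in> {1..N} \<Longrightarrow> exchange x y \<eta> \<in> Omega N"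
  by (auto simp: Omega_def exchange_def PiE_iff extensional_def)

lemma flip_in_Omega: "\<eta> \<in> Omega N \<Longrightarrow> x \<in> {1..N} \<Longrightarrow> flip x \<eta> \<in> Omega N"
  by (fastforce simp: Omega_def flip_def PiE_iff extensional_def)

lemma sep_generator_bound:
  assumes N: "N \<ge> 1" and \<eta>: "\<eta> \<in> Omega N" and f: "\<And>\<zeta>. \<zeta> \<in> Omega N \<Longrightarrow> \<bar>f \<zeta>\<bar> \<le> B"
  shows "\<bar>sep_generator p \<alpha> \<beta> \<gamma> \<delta> N f \<eta>\<bar>
    \<le> 2 * (real N * \<bar>p\<bar> + real N * \<bar>1 - p\<bar> + \<bar>\<alpha>\<bar> + \<bar>\<beta>\<bar> + \<bar>\<gamma>\<bar> + \<bar>\<delta>\<bar>) * B"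
proof -
  have B: "B \<ge> 0" using f[OF \<eta>] by linarith
  have v: "\<eta> x = 0 \<or> \<eta> x = 1" if "x \<in> {1..N}" for x
    using \<eta> that by (auto simp: Omega_def PiE_iff)
  have d: "\<bar>f \<zeta> - f \<eta>\<bar> \<le> 2 * B" if "\<zeta> \<in> Omega N" for \<zeta>
    using f[OF that] f[OF \<eta>] by linarith
  have term_le: "\<bar>c * real (\<eta> x) * (1 - real (\<eta> y)) * (f (exchange x y \<eta>) - f \<eta>)\<bar> \<le> \<bar>c\<bar> * (2 * B)"
    if "x \<in> {1..N}" "y \<in> {1..N}" for c x y
    using v[OF that(1)] v[OF that(2)] d[OF exchange_in_Omega[OF \<eta> that]] B
    by (auto simp: abs_mult intro!: mult_left_mono)
  have flip_le: "\<bar>(a * (1 - real (\<eta> x)) + b * real (\<eta> x)) * (f (flip x \<eta>) - f \<eta>)\<bar>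
      \<le> (\<bar>a\<bar> + \<bar>b\<bar>) * (2 * B)" if "x \<in> {1..N}" for a b x
    unfolding abs_mult using v[OF that] by (intro mult_mono d flip_in_Omega \<eta> that) auto
  have s1: "\<bar>\<Sum>x = 1..N - 1. p * real (\<eta> x) * (1 - real (\<eta> (x + 1))) * (f (exchange x (x + 1) \<eta>) - f \<eta>)\<bar>
      \<le> real N * (\<bar>p\<bar> * (2 * B))"
  proof -
    have "\<bar>\<Sum>x = 1..N - 1. p * real (\<eta> x) * (1 - real (\<eta> (x + 1))) * (f (exchange x (x + 1) \<eta>) - f \<eta>)\<bar>
      \<le> (\<Sum>x = 1..N - 1. \<bar>p\<bar> * (2 * B))"
      by (rule order_trans[OF sum_abs sum_mono]) (rule term_le; auto)
    also have "\<dots> = real (N - 1) * (\<bar>p\<bar> * (2 * B))" by simp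
    also have "\<dots> \<le> real N * (\<bar>p\<bar> * (2 * B))" using B by (intro mult_right_mono) auto
    finally show ?thesis .
  qed
  have s2: "\<bar>\<Sum>x = 2..N. (1 - p) * real (\<eta> x) * (1 - real (\<eta> (x - 1))) * (f (exchange x (x - 1) \<eta>) - f \<eta>)\<bar>
      \<le> real N * (\<bar>1 - p\<bar> * (2 * B))"
  proof -
    have "\<bar>\<Sum>x = 2..N. (1 - p) * real (\<eta> x) * (1 - real (\<eta> (x - 1))) * (f (exchange x (x - 1) \<eta>) - f \<eta>)\<bar>
      \<le> (\<Sum>x = 2..N. \<bar>1 - p\<bar> * (2 * B))"
      by (rule order_trans[OF sum_abs sum_mono]) (rule term_le; auto)
    also have "\<dots> = real (N - 1) * (\<bar>1 - p\<bar> * (2 * B))" by simp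
    also have "\<dots> \<le> real N * (\<bar>1 - p\<bar> * (2 * B))" using B by (intro mult_right_mono) auto
    finally show ?thesis .
  qed
  have s3: "\<bar>a + b + c + e\<bar> \<le> A + A' + A'' + A'''"
    if "\<bar>a\<bar> \<le> A" "\<bar>b\<bar> \<le> A'" "\<bar>c\<bar> \<le> A''" "\<bar>e\<bar> \<le> A'''" for a b c e A A' A'' A''' :: real
    using that by linarith
  have "1 \<in> {1..N}" "N \<in> {1..N}" using N by auto
  from s3[OF s1 s2 flip_le[OF this(1)] flip_le[OF this(2)]] show ?thesis
    unfolding sep_generator_def by (rule order_trans) (simp add: algebra_simps)
qed

lemma sep_generator_pow_bound:
  assumes N: "N \<ge> 1" and f: "\<And>\<zeta>. \<zeta> \<in> Omega N \<Longrightarrow> \<bar>f \<zeta>\<bar> \<le> B" and \<eta>: "\<eta> \<in> Omega N"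
  shows "\<bar>((sep_generator p \<alpha> \<beta> \<gamma> \<delta> N ^^ k) f) \<eta>\<bar>
    \<le> (2 * (real N * \<bar>p\<bar> + real N * \<bar>1 - p\<bar> + \<bar>\<alpha>\<bar> + \<bar>\<beta>\<bar> + \<bar>\<gamma>\<bar> + \<bar>\<delta>\<bar>)) ^ k * B"
  using \<eta>
proof (induction k arbitrary: \<eta>)
  case 0
  then show ?case using f by simp
next
  case (Suc k)
  show ?case
    using sep_generator_bound[OF N Suc.prems Suc.IH, where p = p and \<alpha> = \<alpha> and \<beta> = \<beta> and \<gamma> = \<gamma> and \<delta> = \<delta>] by (simp add: mult.assoc)
qed

lemma sep_semigroup_summable:
  assumes N: "N \<ge> 1" and \<eta>: "\<eta> \<in> Omega N"
  shows "summable (\<lambda>k. \<bar>t ^ k / fact k * ((sep_generator p \<alpha> \<beta> \<gamma> \<delta> N ^^ k) f) \<eta>\<bar>)"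
proof -
  define K where "K = 2 * (real N * \<bar>p\<bar> + real N * \<bar>1 - p\<bar> + \<bar>\<alpha>\<bar> + \<bar>\<beta>\<bar> + \<bar>\<gamma>\<bar> + \<bar>\<delta>\<bar>)"
  define B where "B = (\<Sum>\<zeta>\<in>Omega N. \<bar>f \<zeta>\<bar>)"
  have fin: "finite (Omega N)" unfolding Omega_def by (intro finite_PiE) auto
  have f: "\<bar>f \<zeta>\<bar> \<le> B" if "\<zeta> \<in> Omega N" for \<zeta>
    unfolding B_def using that fin by (intro member_le_sum) auto
  have "summable (\<lambda>k. inverse (fact k) * (\<bar>t\<bar> * K) ^ k * B)"
    by (intro summable_mult2 summable_exp)
  moreover have "norm \<bar>t ^ k / fact k * ((sep_generator p \<alpha> \<beta> \<gamma> \<delta> N ^^ k) f) \<eta>\<bar>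
      \<le> inverse (fact k) * (\<bar>t\<bar> * K) ^ k * B" for k
  proof -
    have "norm \<bar>t ^ k / fact k * ((sep_generator p \<alpha> \<beta> \<gamma> \<delta> N ^^ k) f) \<eta>\<bar>
      = \<bar>t\<bar> ^ k / fact k * \<bar>((sep_generator p \<alpha> \<beta> \<gamma> \<delta> N ^^ k) f) \<eta>\<bar>"
      by (simp add: abs_mult power_abs)
    also have "\<dots> \<le> \<bar>t\<bar> ^ k / fact k * (K ^ k * B)"
      unfolding K_def by (intro mult_left_mono sep_generator_pow_bound N f \<eta>) auto
    finally show ?thesis by (simp add: field_simps power_mult_distrib)
  qed
  ultimately show ?thesis by (rule summable_comparison_test'[where N = 0])
qed

end

theory Submission
  imports Defs "HOL-Real_Asymp.Real_Asymp"
begin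

text \<open>
  At \<open>p = 1/2\<close> the exclusion process is a stirring process: every bond swaps its two values at rate
  \<open>1/2\<close>, and the reservoirs reset the two boundary sites (\<open>generator_stirring\<close>). Two copies driven by
  the same moves and differing at one site never differ at more than one, and this discrepancy performs a
  symmetric random walk on the segment, killed at the ends at rates \<open>\<alpha> + \<gamma>\<close> and \<open>\<beta> + \<delta>\<close>. In
  terms of the semigroup \<open>P\<close>, discrete gradients of \<open>P t f\<close> are controlled by sub- and
  supersolutions of the killed walk (\<open>gradient_decay\<close>). Both halves of the theorem rest on this
  comparison, which replaces the construction of a coupling by the uniformization series.

  Upper bound. At least one killing rate is positive, and a quadratic barrier shows that
  the walk loses mass at a rate of order \<open>1 / N\<^sup>2\<close> (\<open>killing_barrier\<close>). Adding the influences of the \<open>N\<close>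
  sites, \<open>P t f\<close> oscillates by at most \<open>N\<^sup>3 exp (- \<kappa> t)\<close> up to constants
  (\<open>oscillation_decay\<close>). Hence there is exactly one stationary law, and a multiple of \<open>N\<^sup>2 ln N\<close>
  suffices to beat the polynomial prefactor, whatever \<open>\<epsilon>\<close> is.

  Lower bound. Test with the linear observable whose coefficients form the half-wave
  \<open>sin (pi (x - 1) / (N - 1))\<close>. It vanishes at both boundary sites and is therefore a subsolution with rate
  about \<open>pi\<^sup>2 / (2 N\<^sup>2)\<close> for all killing rates, so its means from the full and from the empty
  configuration stay at a distance of order \<open>N exp (- pi\<^sup>2 t / (2 N\<^sup>2))\<close> (\<open>tv_lower_half_wave\<close>). Its variance
  never exceeds \<open>N / 2\<close>: linear observables stay linear, and the variance produced by the dynamics is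
  dominated by the decrease of half the squared norm of the coefficients (\<open>variance_lin\<close>). For \<open>t = c N\<^sup>2 ln N\<close>
  with \<open>c < 1 / pi\<^sup>2\<close> the distance of the means exceeds the standard deviation by a power of \<open>N\<close>, so the
  laws started from the full and from the empty configuration cannot both be close to the
  stationary law, and the total variation distance of one of them tends to 1
  (\<open>tv_dist_second_moment\<close>).
\<close>

section \<open>Stirring representation of the generator\<close>

lemma finite_Omega [simp]: "finite (Omega N)"
  unfolding Omega_def by (intro finite_PiE) auto

lemma Omega_values: "\<eta> \<in> Omega N \<Longrightarrow> x \<in> {1..N} \<Longrightarrow> \<eta> x = 0 \<or> \<eta> x = 1"
  by (auto simp: Omega_def PiE_iff)

lemma upd_in_Omega: "\<eta> \<in> Omega N \<Longrightarrow> x \<in> {1..N} \<Longrightarrow> v \<in> {0, 1} \<Longrightarrow> \<eta>(x := v) \<in> Omega N"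
  by (auto simp: Omega_def PiE_iff extensional_def)

lemma exchange_transpose: "exchange x y \<eta> = \<eta> \<circ> Transposition.transpose x y"
  by (auto simp: exchange_def Transposition.transpose_def fun_eq_iff)

definition empty_config :: "nat \<Rightarrow> config" where
  "empty_config N = (\<lambda>x. if x \<in> {1..N} then 0 else undefined)"

definition full_config :: "nat \<Rightarrow> config" where
  "full_config N = (\<lambda>x. if x \<in> {1..N} then 1 else undefined)"

lemma empty_in_Omega [simp]: "empty_config N \<in> Omega N"
  by (auto simp: Omega_def empty_config_def)

lemma full_in_Omega [simp]: "full_config N \<in> Omega N"
  by (auto simp: Omega_def full_config_def)

text \<open>With at least two sites the two boundary sites are distinct, so that their contributions can be
  treated separately.\<close>

locale open_ssep =
  fixes \<alpha> \<beta> \<gamma> \<delta> :: real and N :: nat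
  assumes nonneg: "0 \<le> \<alpha>" "0 \<le> \<beta>" "0 \<le> \<gamma>" "0 \<le> \<delta>"
    and N2: "2 \<le> N"
begin

abbreviation "L \<equiv> sep_generator (1/2) \<alpha> \<beta> \<gamma> \<delta> N"
abbreviation "P \<equiv> sep_semigroup (1/2) \<alpha> \<beta> \<gamma> \<delta> N"

lemma ends: "1 \<in> {1..N}" "N \<in> {1..N}" "1 \<noteq> N"
  using N2 by auto

text \<open>At \<open>p = 1/2\<close> exclusion is indistinguishable from stirring: a particle facing a hole crosses the
  bond at rate \<open>1/2\<close> in either direction, and swapping two equal values changes nothing, so
  every bond may simply be swapped at rate \<open>1/2\<close>. In the same way a flip at a boundary site becomes
  a resetting of that site to 1 or to 0, independently of its present value. All moves are thus fixed maps
  of the configuration space applied at constant rates; two copies of the process can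
  apply the same moves, and this is the coupling behind every estimate below.\<close>

lemma generator_stirring:
  assumes "\<eta> \<in> Omega N"
  shows "L f \<eta> = (\<Sum>y = 1..N-1. (f (exchange y (y+1) \<eta>) - f \<eta>) / 2)
    + \<alpha> * (f (\<eta>(1 := 1)) - f \<eta>) + \<gamma> * (f (\<eta>(1 := 0)) - f \<eta>)
    + \<delta> * (f (\<eta>(N := 1)) - f \<eta>) + \<beta> * (f (\<eta>(N := 0)) - f \<eta>)"
proof -
  have v: "\<eta> x = 0 \<or> \<eta> x = 1" if "x \<in> {1..N}" for x
    using Omega_values[OF assms that] .
  have 2: "(\<Sum>x = 2..N. (1 - 1/2) * real (\<eta> x) * (1 - real (\<eta> (x - 1))) * (f (exchange x (x - 1) \<eta>) - f \<eta>))
      = (\<Sum>y = 1..N-1. 1/2 * real (\<eta> (y+1)) * (1 - real (\<eta> y)) * (f (exchange (y+1) y \<eta>) - f \<eta>))"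
    using N2 by (intro sum.reindex_bij_witness[of _ "\<lambda>y. y+1" "\<lambda>x. x-1"]) auto
  have "(\<Sum>x = 1..N - 1. 1/2 * real (\<eta> x) * (1 - real (\<eta> (x + 1))) * (f (exchange x (x + 1) \<eta>) - f \<eta>))
      + (\<Sum>y = 1..N-1. 1/2 * real (\<eta> (y+1)) * (1 - real (\<eta> y)) * (f (exchange (y+1) y \<eta>) - f \<eta>))
      = (\<Sum>y = 1..N-1. (f (exchange y (y+1) \<eta>) - f \<eta>) / 2)"
    unfolding sum.distrib[symmetric]
  proof (rule sum.cong[OF refl])
    fix y assume y: "y \<in> {1..N-1}"
    have c: "exchange (y+1) y \<eta> = exchange y (y+1) \<eta>"
      by (auto simp: exchange_def fun_eq_iff)
    have e: "exchange y (y+1) \<eta> = \<eta>" if "\<eta> y = \<eta> (y+1)"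
      using that by (auto simp: exchange_def fun_eq_iff)
    have "y \<in> {1..N}" "y+1 \<in> {1..N}" using y by auto
    from v[OF this(1)] v[OF this(2)] c e
    show "1/2 * real (\<eta> y) * (1 - real (\<eta> (y + 1))) * (f (exchange y (y + 1) \<eta>) - f \<eta>)
      + 1/2 * real (\<eta> (y+1)) * (1 - real (\<eta> y)) * (f (exchange (y+1) y \<eta>) - f \<eta>)
      = (f (exchange y (y+1) \<eta>) - f \<eta>) / 2"
      by auto
  qed
  moreover have bd: "(a * (1 - real (\<eta> x)) + b * real (\<eta> x)) * (f (flip x \<eta>) - f \<eta>)
      = a * (f (\<eta>(x := 1)) - f \<eta>) + b * (f (\<eta>(x := 0)) - f \<eta>)" if "x \<in> {1..N}" for a b x
  proof -
    have "\<eta>(x := \<eta> x) = \<eta>" by simp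
    with v[OF that] show ?thesis by (elim disjE) (simp_all add: flip_def)
  qed
  ultimately show ?thesis
    unfolding sep_generator_def 2 bd[OF ends(1)] bd[OF ends(2)] by simp
qed

section \<open>The semigroup\<close>

lemma gen_cong:
  assumes "\<And>\<zeta>. \<zeta> \<in> Omega N \<Longrightarrow> f \<zeta> = g \<zeta>" "\<eta> \<in> Omega N"
  shows "L f \<eta> = L g \<eta>"
  unfolding generator_stirring[OF assms(2)]
  by (intro arg_cong2[of _ _ _ _ "(+)"] arg_cong2[of _ _ _ _ "(*)"] refl sum.cong
      arg_cong2[of _ _ _ _ "(-)"] arg_cong2[of _ _ _ _ "(/)"] assms upd_in_Omega exchange_in_Omega)
    (use ends in auto)

lemma gen_add: "L (\<lambda>\<zeta>. f \<zeta> + g \<zeta>) \<eta> = L f \<eta> + L g \<eta>"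
  unfolding sep_generator_def add_diff_add distrib_left sum.distrib by (simp only: add_ac)

lemma gen_cmult: "L (\<lambda>\<zeta>. c * f \<zeta>) \<eta> = c * L f \<eta>"
proof -
  have pull: "w * (c * a - c * b) = c * (w * (a - b))" for w a b :: real
    by (simp add: algebra_simps)
  show ?thesis unfolding sep_generator_def pull distrib_left sum_distrib_left by (rule refl)
qed

lemma gen_const: "L (\<lambda>_. c) \<eta> = 0"
  by (simp add: sep_generator_def)

text \<open>The generator evaluates its argument at finitely many configurations, so it may be applied to a
  power series term by term.\<close>

lemma gen_sums:
  assumes h: "\<And>\<zeta>. \<zeta> \<in> Omega N \<Longrightarrow> (\<lambda>k. h k \<zeta>) sums g \<zeta>" and \<eta>: "\<eta> \<in> Omega N"
  shows "(\<lambda>k. L (h k) \<eta>) sums L g \<eta>"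
  unfolding generator_stirring[OF \<eta>]
  by (intro sums_add sums_mult sums_sum sums_diff sums_divide h upd_in_Omega exchange_in_Omega \<eta>)
    (use ends in auto)

lemma gen_pow_add: "(L ^^ k) (\<lambda>\<zeta>. f \<zeta> + g \<zeta>) = (\<lambda>\<eta>. (L ^^ k) f \<eta> + (L ^^ k) g \<eta>)"
  by (induction k) (auto simp: gen_add)

lemma gen_pow_cmult: "(L ^^ k) (\<lambda>\<zeta>. c * f \<zeta>) = (\<lambda>\<eta>. c * (L ^^ k) f \<eta>)"
  by (induction k) (auto simp: gen_cmult)

lemma gen_pow_cong:
  assumes "\<And>\<zeta>. \<zeta> \<in> Omega N \<Longrightarrow> f \<zeta> = g \<zeta>" "\<eta> \<in> Omega N"
  shows "(L ^^ k) f \<eta> = (L ^^ k) g \<eta>"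
  using assms(2) by (induction k arbitrary: \<eta>) (auto intro: gen_cong assms(1))

lemma semigroup_sums:
  assumes "\<eta> \<in> Omega N"
  shows "(\<lambda>k. t ^ k / fact k * (L ^^ k) f \<eta>) sums P t f \<eta>"
  unfolding sep_semigroup_def
  using sep_semigroup_summable[of N \<eta> t "1/2" \<alpha> \<beta> \<gamma> \<delta> f] N2 assms
  by (intro summable_sums) (auto intro: summable_rabs_cancel)

lemma semigroup_add: "\<eta> \<in> Omega N \<Longrightarrow> P t (\<lambda>\<zeta>. f \<zeta> + g \<zeta>) \<eta> = P t f \<eta> + P t g \<eta>"
  using sums_add[OF semigroup_sums[of \<eta> t f] semigroup_sums[of \<eta> t g]]
    semigroup_sums[of \<eta> t "\<lambda>\<zeta>. f \<zeta> + g \<zeta>"]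
  by (simp add: gen_pow_add ring_distribs sums_iff)

lemma semigroup_cmult: "\<eta> \<in> Omega N \<Longrightarrow> P t (\<lambda>\<zeta>. c * f \<zeta>) \<eta> = c * P t f \<eta>"
  using sums_mult[OF semigroup_sums[of \<eta> t f], of c] semigroup_sums[of \<eta> t "\<lambda>\<zeta>. c * f \<zeta>"]
  by (simp add: gen_pow_cmult sums_iff mult_ac)

lemma semigroup_uminus: "\<eta> \<in> Omega N \<Longrightarrow> P t (\<lambda>\<zeta>. - f \<zeta>) \<eta> = - P t f \<eta>"
  using semigroup_cmult[of \<eta> t "-1" f] by simp

lemma semigroup_diff: "\<eta> \<in> Omega N \<Longrightarrow> P t (\<lambda>\<zeta>. f \<zeta> - g \<zeta>) \<eta> = P t f \<eta> - P t g \<eta>"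
  using semigroup_add[of \<eta> t f "\<lambda>\<zeta>. - g \<zeta>"] by (simp add: semigroup_uminus)

lemma semigroup_cong:
  assumes "\<And>\<zeta>. \<zeta> \<in> Omega N \<Longrightarrow> f \<zeta> = g \<zeta>" "\<eta> \<in> Omega N"
  shows "P t f \<eta> = P t g \<eta>"
  unfolding sep_semigroup_def using gen_pow_cong[OF assms] by simp

lemma semigroup_const: "P t (\<lambda>_. c) \<eta> = c"
proof -
  have "(L ^^ Suc k) (\<lambda>_. c) = (\<lambda>_. 0)" for k
    by (induction k) (auto simp: gen_const)
  hence "(L ^^ k) (\<lambda>_. c) \<eta> = 0" if "k > 0" for k
    using that by (cases k) auto
  thus ?thesis unfolding sep_semigroup_def
    by (subst suminf_finite[of "{0}"]) auto
qed

lemma semigroup_zero: "\<eta> \<in> Omega N \<Longrightarrow> P 0 f \<eta> = f \<eta>"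
  unfolding sep_semigroup_def by (subst suminf_finite[of "{0}"]) auto

lemma semigroup_sum:
  "finite S \<Longrightarrow> \<eta> \<in> Omega N \<Longrightarrow> P t (\<lambda>\<zeta>. \<Sum>i\<in>S. f i \<zeta>) \<eta> = (\<Sum>i\<in>S. P t (f i) \<eta>)"
  by (induction S rule: finite_induct) (auto simp: semigroup_add semigroup_const)

lemma gen_sum:
  "finite S \<Longrightarrow> L (\<lambda>\<zeta>. \<Sum>i\<in>S. f i \<zeta>) \<eta> = (\<Sum>i\<in>S. L (f i) \<eta>)"
  by (induction S rule: finite_induct) (auto simp: gen_add gen_const)

lemma indicator_expansion:
  fixes f :: "config \<Rightarrow> real"
  shows "\<zeta> \<in> Omega N \<Longrightarrow> f \<zeta> = (\<Sum>\<xi>\<in>Omega N. f \<xi> * indicator {\<xi>} \<zeta>)"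
proof -
  assume \<zeta>: "\<zeta> \<in> Omega N"
  have "(\<Sum>\<xi>\<in>Omega N. f \<xi> * indicator {\<xi>} \<zeta>) = (\<Sum>\<xi>\<in>Omega N. if \<xi> = \<zeta> then f \<zeta> else 0)"
    by (intro sum.cong) auto
  thus ?thesis using \<zeta> by simp
qed

text \<open>Expanding a function in point masses reduces time derivatives of \<open>P (t - s) (u s)\<close>, where both
  factors move, to products of scalar functions.\<close>

lemma semigroup_transition:
  assumes "\<eta> \<in> Omega N"
  shows "P t f \<eta> = (\<Sum>\<xi>\<in>Omega N. P t (indicator {\<xi>}) \<eta> * f \<xi>)"
proof -
  have "P t f \<eta> = P t (\<lambda>\<zeta>. \<Sum>\<xi>\<in>Omega N. f \<xi> * indicator {\<xi>} \<zeta>) \<eta>"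
    by (rule semigroup_cong[OF indicator_expansion assms])
  also have "\<dots> = (\<Sum>\<xi>\<in>Omega N. P t (\<lambda>\<zeta>. f \<xi> * indicator {\<xi>} \<zeta>) \<eta>)"
    by (rule semigroup_sum) (use assms in auto)
  finally show ?thesis by (simp add: semigroup_cmult assms mult_ac)
qed

lemma semigroup_deriv_right:
  assumes "\<eta> \<in> Omega N"
  shows "((\<lambda>t. P t f \<eta>) has_real_derivative P t (L f) \<eta>) (at t)"
proof -
  define c where "c k = (L ^^ k) f \<eta> / fact k" for k
  have s: "summable (\<lambda>k. c k * t ^ k)" for t
    using semigroup_sums[OF assms, of t f] by (simp add: c_def sums_iff mult_ac)
  have "((\<lambda>t. \<Sum>k. c k * t ^ k) has_real_derivative (\<Sum>k. diffs c k * t ^ k)) (at t)"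
    by (rule termdiffs_strong_converges_everywhere[OF s])
  moreover have "(\<Sum>k. c k * t ^ k) = P t f \<eta>" for t
    by (simp add: sep_semigroup_def c_def mult_ac)
  moreover have "diffs c k * t ^ k = t ^ k / fact k * (L ^^ k) (L f) \<eta>" for k
    by (simp add: diffs_def c_def funpow_swap1 del: of_nat_Suc)
  ultimately show ?thesis by (simp add: sep_semigroup_def)
qed

lemma gen_semigroup_commute:
  assumes "\<eta> \<in> Omega N"
  shows "L (P t f) \<eta> = P t (L f) \<eta>"
proof -
  have "(\<lambda>k. L (\<lambda>\<zeta>. t ^ k / fact k * (L ^^ k) f \<zeta>) \<eta>) sums L (P t f) \<eta>"
    by (rule gen_sums[OF semigroup_sums assms])
  moreover have "L (\<lambda>\<zeta>. t ^ k / fact k * (L ^^ k) f \<zeta>) \<eta> = t ^ k / fact k * (L ^^ k) (L f) \<eta>" for k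
    by (simp only: gen_cmult) (simp add: funpow_swap1)
  ultimately show ?thesis
    using semigroup_sums[OF assms, of t "L f"] sums_unique2 by auto
qed

lemma semigroup_deriv:
  assumes "\<eta> \<in> Omega N"
  shows "((\<lambda>t. P t f \<eta>) has_real_derivative L (P t f) \<eta>) (at t)"
  using semigroup_deriv_right[OF assms] by (simp add: gen_semigroup_commute assms)

definition total_rate :: real where
  "total_rate = real (N - 1) / 2 + \<alpha> + \<beta> + \<gamma> + \<delta>"

text \<open>The sum, over all moves weighted by their rates, of the function after the move. Unlike the
  generator it preserves positivity.\<close>

definition jumps :: "(config \<Rightarrow> real) \<Rightarrow> config \<Rightarrow> real" where
  "jumps f \<eta> = L f \<eta> + total_rate * f \<eta>"

lemma jumps_stirring:
  assumes "\<eta> \<in> Omega N"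
  shows "jumps f \<eta> = (\<Sum>y = 1..N-1. f (exchange y (y+1) \<eta>) / 2)
    + \<alpha> * f (\<eta>(1 := 1)) + \<gamma> * f (\<eta>(1 := 0)) + \<delta> * f (\<eta>(N := 1)) + \<beta> * f (\<eta>(N := 0))"
  unfolding jumps_def generator_stirring[OF assms] total_rate_def
  by (simp add: diff_divide_distrib sum_subtractf algebra_simps)

lemma jumps_pow_binomial:
  "(jumps ^^ k) f \<eta> = (\<Sum>j\<le>k. real (k choose j) * total_rate ^ (k - j) * (L ^^ j) f \<eta>)"
proof (induction k arbitrary: \<eta>)
  case (Suc k)
  let ?g = "\<lambda>j. total_rate ^ (Suc k - j) * (L ^^ j) f \<eta>"
  have IH: "(jumps ^^ k) f = (\<lambda>\<eta>. \<Sum>j\<le>k. real (k choose j) * total_rate ^ (k - j) * (L ^^ j) f \<eta>)"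
    using Suc.IH by auto
  have "(jumps ^^ Suc k) f \<eta> = L ((jumps ^^ k) f) \<eta> + total_rate * (jumps ^^ k) f \<eta>"
    by (simp add: jumps_def)
  also have "L ((jumps ^^ k) f) \<eta> = (\<Sum>j\<le>k. real (k choose j) * total_rate ^ (k - j) * (L ^^ Suc j) f \<eta>)"
    unfolding IH by (simp add: gen_sum gen_cmult)
  also have "total_rate * (jumps ^^ k) f \<eta> = (\<Sum>j\<le>k. real (k choose j) * ?g j)"
    unfolding IH sum_distrib_left by (intro sum.cong) (auto simp: Suc_diff_le mult_ac)
  also have "(\<Sum>j\<le>k. real (k choose j) * ?g j) = (\<Sum>j\<le>Suc k. real (k choose j) * ?g j)"
    by simp
  also have "\<dots> = ?g 0 + (\<Sum>j\<le>k. real (k choose Suc j) * ?g (Suc j))"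
    by (subst sum.atMost_Suc_shift) simp
  also have "(\<Sum>j\<le>k. real (k choose j) * total_rate ^ (k - j) * (L ^^ Suc j) f \<eta>)
     + (?g 0 + (\<Sum>j\<le>k. real (k choose Suc j) * ?g (Suc j)))
     = ?g 0 + (\<Sum>j\<le>k. real (Suc k choose Suc j) * ?g (Suc j))"
    by (simp add: sum.distrib[symmetric] ring_distribs mult_ac)
  also have "\<dots> = (\<Sum>j\<le>Suc k. real (Suc k choose j) * ?g j)"
    by (subst sum.atMost_Suc_shift) simp
  finally show ?case by (simp add: mult_ac)
qed simp

text \<open>The chain moves at the times of a Poisson process of intensity \<open>total_rate\<close>, and \<open>jumps\<close>
  applied \<open>k\<close> times accounts for \<open>k\<close> moves. Analytically, \<open>jumps\<close> is the generator plus a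
  multiple of the identity, so that the exponential series multiply by the Cauchy product formula. Any inequality
  that survives one application of \<open>jumps\<close> therefore passes to the semigroup.\<close>

lemma uniformization:
  assumes \<eta>: "\<eta> \<in> Omega N"
  shows "(\<lambda>k. exp (- total_rate * t) * (t ^ k / fact k * (jumps ^^ k) f \<eta>)) sums P t f \<eta>"
proof -
  define a where "a j = t ^ j / fact j * (L ^^ j) f \<eta>" for j
  define b where "b j = (total_rate * t) ^ j / fact j" for j
  have "summable (\<lambda>k. norm (a k))"
    using sep_semigroup_summable[of N \<eta> t "1/2" \<alpha> \<beta> \<gamma> \<delta> f] N2 \<eta>
    unfolding a_def real_norm_def by simp
  moreover have "summable (\<lambda>k. norm (b k))"
    using summable_norm_exp[of "total_rate * t"] by (simp add: b_def divide_inverse mult_ac)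
  ultimately have "(\<lambda>k. \<Sum>j\<le>k. a j * b (k - j)) sums ((\<Sum>k. a k) * (\<Sum>k. b k))"
    by (rule Cauchy_product_sums)
  moreover have "(\<Sum>k. a k) = P t f \<eta>"
    using semigroup_sums[OF \<eta>] by (simp add: a_def sums_iff)
  moreover have "(\<Sum>k. b k) = exp (total_rate * t)"
    by (simp add: exp_def b_def divide_inverse mult_ac)
  moreover have "(\<Sum>j\<le>k. a j * b (k - j)) = t ^ k / fact k * (jumps ^^ k) f \<eta>" for k
    unfolding jumps_pow_binomial sum_distrib_left
  proof (rule sum.cong[OF refl])
    fix j assume j: "j \<in> {..k}"
    have "t ^ k = t ^ j * t ^ (k - j)" using j by (simp flip: power_add)
    thus "a j * b (k - j) = t ^ k / fact k * (real (k choose j) * total_rate ^ (k - j) * (L ^^ j) f \<eta>)"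
      using j by (simp add: a_def b_def binomial_fact power_mult_distrib field_simps)
  qed
  ultimately have "(\<lambda>k. t ^ k / fact k * (jumps ^^ k) f \<eta>) sums (P t f \<eta> * exp (total_rate * t))" by simp
  from sums_mult[OF this, of "exp (- total_rate * t)"] show ?thesis
    by (simp add: exp_minus field_simps)
qed

lemma jumps_nonneg:
  assumes "\<And>\<zeta>. \<zeta> \<in> Omega N \<Longrightarrow> 0 \<le> f \<zeta>" "\<eta> \<in> Omega N"
  shows "0 \<le> jumps f \<eta>"
  unfolding jumps_stirring[OF assms(2)]
  by (intro add_nonneg_nonneg mult_nonneg_nonneg sum_nonneg divide_nonneg_nonneg nonneg
      assms upd_in_Omega exchange_in_Omega) (use ends in auto)

lemma semigroup_nonneg:
  assumes f: "\<And>\<zeta>. \<zeta> \<in> Omega N \<Longrightarrow> 0 \<le> f \<zeta>" and "\<eta> \<in> Omega N" "0 \<le> t"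
  shows "0 \<le> P t f \<eta>"
proof -
  have "0 \<le> (jumps ^^ k) f \<zeta>" if "\<zeta> \<in> Omega N" for k \<zeta>
    using that by (induction k arbitrary: \<zeta>) (auto intro: f jumps_nonneg)
  thus ?thesis
    using uniformization[OF assms(2), of t f] assms
    by (intro sums_le[OF _ sums_zero uniformization[OF assms(2)]]) auto
qed

lemma semigroup_mono:
  assumes f: "\<And>\<zeta>. \<zeta> \<in> Omega N \<Longrightarrow> f \<zeta> \<le> g \<zeta>" and "\<eta> \<in> Omega N" "0 \<le> t"
  shows "P t f \<eta> \<le> P t g \<eta>"
  using semigroup_nonneg[of "\<lambda>\<zeta>. g \<zeta> - f \<zeta>" \<eta> t] assms by (simp add: semigroup_diff)

text \<open>A supersolution of the backward equation dominates the solution: along \<open>s\<close> the quantity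
  \<open>P (t - s) (u s)\<close> has derivative \<open>P (t - s) (u' s - L (u s))\<close>, which is nonnegative, and it interpolates between
  \<open>P t (u 0)\<close> and \<open>u t\<close>.\<close>

lemma comparison:
  assumes u: "\<And>s \<zeta>. \<zeta> \<in> Omega N \<Longrightarrow> 0 \<le> s \<Longrightarrow> s \<le> t \<Longrightarrow>
      ((\<lambda>s. u s \<zeta>) has_real_derivative u' s \<zeta>) (at s)"
    and super: "\<And>s \<zeta>. \<zeta> \<in> Omega N \<Longrightarrow> 0 \<le> s \<Longrightarrow> s \<le> t \<Longrightarrow> L (u s) \<zeta> \<le> u' s \<zeta>"
    and \<eta>: "\<eta> \<in> Omega N" and t: "0 \<le> t"
  shows "P t (u 0) \<eta> \<le> u t \<eta>"
proof -
  define G where "G s = (\<Sum>\<xi>\<in>Omega N. P (t - s) (indicator {\<xi>}) \<eta> * u s \<xi>)" for s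
  have G: "G s = P (t - s) (u s) \<eta>" for s
    unfolding G_def by (rule semigroup_transition[OF \<eta>, symmetric])
  have "G 0 \<le> G t"
  proof (rule DERIV_nonneg_imp_nondecreasing[OF t])
    fix s assume s: "0 \<le> s" "s \<le> t"
    have d: "((\<lambda>s. P (t - s) (indicator {\<xi>}) \<eta>) has_real_derivative
        - P (t - s) (L (indicator {\<xi>})) \<eta>) (at s)" for \<xi>
      by (rule DERIV_cong[OF DERIV_chain'[OF _ semigroup_deriv_right[OF \<eta>]]])
        (auto intro!: derivative_eq_intros)
    let ?D = "(\<Sum>\<xi>\<in>Omega N. - P (t - s) (L (indicator {\<xi>})) \<eta> * u s \<xi>
        + P (t - s) (indicator {\<xi>}) \<eta> * u' s \<xi>)"
    have "(G has_real_derivative ?D) (at s)"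
      unfolding G_def
      by (rule DERIV_cong[OF DERIV_sum[OF DERIV_mult[OF d u]]]) (use s in \<open>auto simp: mult_ac\<close>)
    moreover have "?D = P (t - s) (\<lambda>\<zeta>. u' s \<zeta> - L (u s) \<zeta>) \<eta>"
    proof -
      have "(\<Sum>\<xi>\<in>Omega N. P (t - s) (L (indicator {\<xi>})) \<eta> * u s \<xi>)
          = P (t - s) (\<lambda>\<zeta>. \<Sum>\<xi>\<in>Omega N. u s \<xi> * L (indicator {\<xi>}) \<zeta>) \<eta>"
        by (simp add: semigroup_sum semigroup_cmult \<eta> mult_ac)
      also have "\<dots> = P (t - s) (L (u s)) \<eta>"
      proof (rule semigroup_cong[OF _ \<eta>])
        fix \<zeta> assume \<zeta>: "\<zeta> \<in> Omega N"
        have "L (u s) \<zeta> = L (\<lambda>\<zeta>. \<Sum>\<xi>\<in>Omega N. u s \<xi> * indicator {\<xi>} \<zeta>) \<zeta>"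
          by (rule gen_cong[OF indicator_expansion \<zeta>])
        thus "(\<Sum>\<xi>\<in>Omega N. u s \<xi> * L (indicator {\<xi>}) \<zeta>) = L (u s) \<zeta>"
          by (simp only: gen_sum finite_Omega gen_cmult)
      qed
      finally show ?thesis
        using semigroup_transition[OF \<eta>, of "t-s" "u' s"]
        by (simp add: semigroup_diff \<eta> sum.distrib sum_negf sum_subtractf)
    qed
    moreover have "0 \<le> P (t - s) (\<lambda>\<zeta>. u' s \<zeta> - L (u s) \<zeta>) \<eta>"
      using super s \<eta> by (intro semigroup_nonneg) auto
    ultimately show "\<exists>y. (G has_real_derivative y) (at s) \<and> 0 \<le> y" by auto
  qed
  thus ?thesis unfolding G by (simp add: semigroup_zero \<eta>)
qed

text \<open>Both \<open>P (s + r) f\<close> and its negative solve the backward equation, so the comparison principle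
  applies in both directions.\<close>

lemma semigroup_semigroup:
  assumes \<eta>: "\<eta> \<in> Omega N" and t: "0 \<le> t"
  shows "P t (P r f) \<eta> = P (t + r) f \<eta>"
proof -
  have d: "((\<lambda>s. P (s + r) f \<zeta>) has_real_derivative L (P (s + r) f) \<zeta>) (at s)" if "\<zeta> \<in> Omega N" for s \<zeta> f
    by (rule DERIV_cong[OF DERIV_chain'[OF _ semigroup_deriv[OF that]]])
      (auto intro!: derivative_eq_intros)
  have le: "P t (P r f) \<eta> \<le> P (t + r) f \<eta>" for f
    using comparison[of t "\<lambda>s. P (s + r) f" "\<lambda>s. L (P (s + r) f)", OF d order_refl \<eta> t] by simp
  have "P t (P r (\<lambda>\<zeta>. - f \<zeta>)) \<eta> = P t (\<lambda>\<zeta>. - P r f \<zeta>) \<eta>"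
    by (rule semigroup_cong[OF semigroup_uminus \<eta>])
  with le[of "\<lambda>\<zeta>. - f \<zeta>"] le[of f] show ?thesis by (simp add: semigroup_uminus \<eta>)
qed

section \<open>Discrepancies perform a killed random walk\<close>

text \<open>Two coupled copies that differ at a single site \<open>x\<close> keep differing at a single site, which is
  carried along by the swaps and disappears when a reservoir resets it. The operator
  below generates this discrepancy: a symmetric walk with jump rate \<open>1/2\<close> per bond, killed
  at rate \<open>\<alpha> + \<gamma>\<close> at site 1 and \<open>\<beta> + \<delta>\<close> at site \<open>N\<close>. It is written as a sum over bonds because this form
  fits the stirring representation and makes the operator visibly symmetric.\<close>

definition walk :: "(nat \<Rightarrow> real) \<Rightarrow> nat \<Rightarrow> real" where
  "walk \<psi> x = (\<Sum>y = 1..N-1. (\<psi> (Transposition.transpose y (y+1) x) - \<psi> x) / 2)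
    - (if x = 1 then (\<alpha> + \<gamma>) * \<psi> x else 0) - (if x = N then (\<beta> + \<delta>) * \<psi> x else 0)"

lemma walk_steps:
  assumes "x \<in> {1..N}"
  shows "walk \<psi> x = (if x < N then (\<psi> (x+1) - \<psi> x) / 2 else 0) + (if 1 < x then (\<psi> (x-1) - \<psi> x) / 2 else 0)
    - (if x = 1 then (\<alpha> + \<gamma>) * \<psi> x else 0) - (if x = N then (\<beta> + \<delta>) * \<psi> x else 0)"
proof -
  have "(\<Sum>y = 1..N-1. (\<psi> (Transposition.transpose y (y+1) x) - \<psi> x) / 2)
    = (\<Sum>y = 1..N-1. (if y = x then (\<psi> (x+1) - \<psi> x) / 2 else 0) + (if y = x-1 then (\<psi> (x-1) - \<psi> x) / 2 else 0))"
    by (intro sum.cong) (auto simp: Transposition.transpose_def)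
  also have "\<dots> = (if x < N then (\<psi> (x+1) - \<psi> x) / 2 else 0) + (if 1 < x then (\<psi> (x-1) - \<psi> x) / 2 else 0)"
    using assms unfolding sum.distrib by (simp add: sum.delta) auto
  finally show ?thesis unfolding walk_def by simp
qed

lemma walk_cmult: "walk (\<lambda>x. c * \<psi> x) x = c * walk \<psi> x"
  unfolding walk_def by (simp add: right_diff_distrib sum_distrib_left diff_divide_distrib)

text \<open>A one-sided bound suffices: upper bounds on the influence of a site come from
  applying it to \<open>f\<close> and \<open>- f\<close> with a negative profile, and lower bounds from a nonnegative
  profile.\<close>

definition grad_ge :: "(config \<Rightarrow> real) \<Rightarrow> (nat \<Rightarrow> real) \<Rightarrow> bool" where
  "grad_ge f \<psi> \<longleftrightarrow> (\<forall>\<eta>\<in>Omega N. \<forall>x\<in>{1..N}. \<eta> x = 0 \<longrightarrow> \<psi> x \<le> f (\<eta>(x := 1)) - f \<eta>)"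

text \<open>Apply each move to both configurations: a swap moves the discrepancy from \<open>x\<close> to its image under
  the transposition, and a reset at \<open>x\<close> removes it. The left side is the resulting average of
  the profile.\<close>

lemma jumps_gradient:
  assumes g: "grad_ge f \<psi>" and \<eta>: "\<eta> \<in> Omega N" and x: "x \<in> {1..N}" "\<eta> x = 0"
  shows "total_rate * \<psi> x + walk \<psi> x \<le> jumps f (\<eta>(x := 1)) - jumps f \<eta>"
proof -
  have \<eta>': "\<eta>(x := 1) \<in> Omega N" by (intro upd_in_Omega \<eta> x) auto
  have sw: "\<psi> (Transposition.transpose y (y+1) x) / 2 \<le> f (exchange y (y+1) (\<eta>(x := 1))) / 2 - f (exchange y (y+1) \<eta>) / 2"
    if y: "y \<in> {1..N-1}" for y
  proof -
    let ?x = "Transposition.transpose y (y+1) x"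
    have "exchange y (y+1) (\<eta>(x := 1)) = (exchange y (y+1) \<eta>)(?x := 1)"
      by (auto simp: exchange_def Transposition.transpose_def fun_eq_iff)
    moreover have "exchange y (y+1) \<eta> ?x = 0" using x by (simp add: exchange_transpose)
    moreover have "?x \<in> {1..N}" using x y by (auto simp: Transposition.transpose_def)
    moreover have "exchange y (y+1) \<eta> \<in> Omega N" using y by (intro exchange_in_Omega \<eta>) auto
    ultimately have "\<psi> ?x \<le> f (exchange y (y+1) (\<eta>(x := 1))) - f (exchange y (y+1) \<eta>)"
      using g unfolding grad_ge_def by auto
    thus ?thesis by simp
  qed
  have bd: "r * (if x = z then 0 else \<psi> x) \<le> r * f ((\<eta>(x := 1))(z := v)) - r * f (\<eta>(z := v))"
    if "0 \<le> r" "z \<in> {1..N}" "v \<in> {0, 1}" for r z v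
  proof (cases "x = z")
    case False
    have "\<eta>(z := v) \<in> Omega N" by (intro upd_in_Omega \<eta> that)
    hence "\<psi> x \<le> f ((\<eta>(z := v))(x := 1)) - f (\<eta>(z := v))"
      using g x False unfolding grad_ge_def by auto
    from mult_left_mono[OF this \<open>0 \<le> r\<close>] False show ?thesis
      by (simp add: fun_upd_twist right_diff_distrib)
  qed simp
  have "(\<Sum>y = 1..N-1. \<psi> (Transposition.transpose y (y+1) x) / 2)
      \<le> (\<Sum>y = 1..N-1. f (exchange y (y+1) (\<eta>(x := 1))) / 2) - (\<Sum>y = 1..N-1. f (exchange y (y+1) \<eta>) / 2)"
    unfolding sum_subtractf[symmetric] by (intro sum_mono sw)
  moreover have "total_rate * \<psi> x + walk \<psi> x = (\<Sum>y = 1..N-1. \<psi> (Transposition.transpose y (y+1) x) / 2)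
     + \<alpha> * (if x = 1 then 0 else \<psi> x) + \<gamma> * (if x = 1 then 0 else \<psi> x)
     + \<delta> * (if x = N then 0 else \<psi> x) + \<beta> * (if x = N then 0 else \<psi> x)"
    unfolding walk_def total_rate_def by (simp add: diff_divide_distrib sum_subtractf algebra_simps)
  ultimately show ?thesis
    unfolding jumps_stirring[OF \<eta>] jumps_stirring[OF \<eta>']
    using bd[OF nonneg(1) ends(1), of 1] bd[OF nonneg(3) ends(1), of 0]
      bd[OF nonneg(4) ends(2), of 1] bd[OF nonneg(2) ends(2), of 0] by simp
qed

text \<open>The single estimate used for both halves of the theorem. A negative \<open>\<psi>\<close> satisfying the
  hypothesis says that \<open>- \<psi>\<close> is a supersolution for the killed walk, and then the influence of each site
  decays at least at rate \<open>\<kappa>\<close>; a nonnegative \<open>\<psi>\<close> is a subsolution, and then the influence decays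
  at most at rate \<open>\<kappa>\<close>.\<close>

lemma gradient_decay:
  assumes g: "grad_ge f \<psi>" and sub: "\<And>x. x \<in> {1..N} \<Longrightarrow> - (\<kappa> * \<psi> x) \<le> walk \<psi> x"
    and \<kappa>: "\<kappa> \<le> total_rate" and t: "0 \<le> t"
  shows "grad_ge (P t f) (\<lambda>x. exp (- \<kappa> * t) * \<psi> x)"
proof -
  \<comment> \<open>The requirement \<open>\<kappa> \<le> total_rate\<close> keeps the factors nonnegative, so the inequality for \<open>walk\<close> can be iterated.\<close>
  have Mk: "grad_ge ((jumps ^^ k) f) (\<lambda>x. (total_rate - \<kappa>) ^ k * \<psi> x)" for k
  proof (induction k)
    case (Suc k)
    show ?case unfolding grad_ge_def
    proof (intro ballI impI)
      fix \<eta> x assume a: "\<eta> \<in> Omega N" "x \<in> {1..N}" "\<eta> x = 0"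
      have "(total_rate - \<kappa>) ^ Suc k * \<psi> x = (total_rate - \<kappa>) ^ k * (total_rate * \<psi> x + - (\<kappa> * \<psi> x))"
        by (simp add: algebra_simps)
      also have "\<dots> \<le> (total_rate - \<kappa>) ^ k * (total_rate * \<psi> x + walk \<psi> x)"
        using \<kappa> sub[OF a(2)] by (intro mult_left_mono) auto
      also have "\<dots> = total_rate * ((total_rate - \<kappa>) ^ k * \<psi> x) + walk (\<lambda>x. (total_rate - \<kappa>) ^ k * \<psi> x) x"
        unfolding walk_cmult by (simp add: algebra_simps)
      also have "\<dots> \<le> jumps ((jumps ^^ k) f) (\<eta>(x := 1)) - jumps ((jumps ^^ k) f) \<eta>"
        by (rule jumps_gradient[OF Suc.IH a])
      finally show "(total_rate - \<kappa>) ^ Suc k * \<psi> x \<le> (jumps ^^ Suc k) f (\<eta>(x := 1)) - (jumps ^^ Suc k) f \<eta>" by simp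
    qed
  qed (use g in simp)
  show ?thesis unfolding grad_ge_def
  proof (intro ballI impI)
    fix \<eta> x assume a: "\<eta> \<in> Omega N" "x \<in> {1..N}" "\<eta> x = 0"
    have \<eta>': "\<eta>(x := 1) \<in> Omega N" by (intro upd_in_Omega a) auto
    have s: "(\<lambda>k. exp (- total_rate * t) * \<psi> x * ((t * (total_rate - \<kappa>)) ^ k /\<^sub>R fact k)) sums (exp (- total_rate * t) * \<psi> x * exp (t * (total_rate - \<kappa>)))"
      by (intro sums_mult exp_converges)
    have "exp (- total_rate * t) * exp (t * (total_rate - \<kappa>)) = exp (- \<kappa> * t)"
      by (simp add: algebra_simps flip: exp_add)
    hence e: "exp (- total_rate * t) * \<psi> x * exp (t * (total_rate - \<kappa>)) = exp (- \<kappa> * t) * \<psi> x"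
      by (metis mult.assoc mult.commute)
    have 1: "(\<lambda>k. exp (- total_rate * t) * (t ^ k / fact k * ((total_rate - \<kappa>) ^ k * \<psi> x))) sums (exp (- \<kappa> * t) * \<psi> x)"
      using s unfolding e by (simp add: power_mult_distrib divide_inverse mult_ac)
    have 2: "(\<lambda>k. exp (- total_rate * t) * (t ^ k / fact k * ((jumps ^^ k) f (\<eta>(x := 1)) - (jumps ^^ k) f \<eta>)))
        sums (P t f (\<eta>(x := 1)) - P t f \<eta>)"
      using sums_diff[OF uniformization[OF \<eta>', of t f] uniformization[OF a(1), of t f]]
      by (simp add: right_diff_distrib)
    show "exp (- \<kappa> * t) * \<psi> x \<le> P t f (\<eta>(x := 1)) - P t f \<eta>"
    proof (rule sums_le[OF _ 1 2])
      show "exp (- total_rate * t) * (t ^ k / fact k * ((total_rate - \<kappa>) ^ k * \<psi> x))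
        \<le> exp (- total_rate * t) * (t ^ k / fact k * ((jumps ^^ k) f (\<eta>(x := 1)) - (jumps ^^ k) f \<eta>))" for k
        using Mk[of k] a t unfolding grad_ge_def by (intro mult_left_mono) simp_all
    qed
  qed
qed

text \<open>Fill the sites of \<open>\<eta>\<close> one after another from the left, starting from the empty configuration,
  and add the gradients met on the way.\<close>

lemma gradient_total:
  assumes g: "grad_ge f \<psi>" and \<eta>: "\<eta> \<in> Omega N"
  shows "(\<Sum>x = 1..N. \<psi> x * real (\<eta> x)) \<le> f \<eta> - f (empty_config N)"
proof -
  define c where "c k = (\<lambda>x. if x \<in> {1..N} then if x \<le> k then \<eta> x else 0 else undefined)" for k
  have c: "c k \<in> Omega N" for k
    using Omega_values[OF \<eta>] by (auto simp: Omega_def c_def PiE_iff extensional_def)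
  have "(\<Sum>x = 1..k. \<psi> x * real (\<eta> x)) \<le> f (c k) - f (empty_config N)" if "k \<le> N" for k
    using that
  proof (induction k)
    case 0
    have "c 0 = empty_config N" by (auto simp: c_def empty_config_def fun_eq_iff)
    thus ?case by simp
  next
    case (Suc k)
    have S: "Suc k \<in> {1..N}" using Suc.prems by auto
    show ?case
    proof (cases "\<eta> (Suc k) = 0")
      case True
      hence "c (Suc k) = c k" by (auto simp: c_def fun_eq_iff le_Suc_eq)
      thus ?thesis using Suc True by simp
    next
      case False
      hence 1: "\<eta> (Suc k) = 1" using Omega_values[OF \<eta> S] by simp
      hence e: "c (Suc k) = (c k)(Suc k := 1)" using S by (auto simp: c_def fun_eq_iff le_Suc_eq)
      have "\<psi> (Suc k) \<le> f (c (Suc k)) - f (c k)"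
        unfolding e using g c S unfolding grad_ge_def by (auto simp: c_def)
      thus ?thesis using Suc 1 by simp
    qed
  qed
  moreover have "c N = \<eta>"
    using \<eta> by (auto simp: c_def fun_eq_iff Omega_def PiE_iff extensional_def)
  ultimately show ?thesis by force
qed

section \<open>Fluctuations of linear observables\<close>

definition lin :: "real \<Rightarrow> (nat \<Rightarrow> real) \<Rightarrow> config \<Rightarrow> real" where
  "lin c \<psi> \<eta> = c + (\<Sum>x = 1..N. \<psi> x * real (\<eta> x))"

lemma lin_exchange:
  assumes "y \<in> {1..N-1}"
  shows "lin c \<psi> (exchange y (y+1) \<eta>) - lin c \<psi> \<eta>
    = (\<Sum>x = 1..N. (\<psi> (Transposition.transpose y (y+1) x) - \<psi> x) * real (\<eta> x))"
proof -
  let ?\<tau> = "Transposition.transpose y (y+1)"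
  have "(\<Sum>x = 1..N. \<psi> x * real (exchange y (y+1) \<eta> x)) = (\<Sum>x = 1..N. \<psi> (?\<tau> x) * real (\<eta> x))"
    unfolding exchange_transpose using assms
    by (intro sum.reindex_bij_witness[of _ ?\<tau> ?\<tau>]) (auto simp: Transposition.transpose_def)
  thus ?thesis by (simp add: lin_def left_diff_distrib sum_subtractf)
qed

lemma lin_exchange':
  assumes "y \<in> {1..N-1}"
  shows "lin c \<psi> (exchange y (y+1) \<eta>) - lin c \<psi> \<eta> = (\<psi> (y+1) - \<psi> y) * (real (\<eta> y) - real (\<eta> (y+1)))"
proof -
  have "lin c \<psi> (exchange y (y+1) \<eta>) - lin c \<psi> \<eta>
     = (\<Sum>x = 1..N. (if x = y then (\<psi> (y+1) - \<psi> y) * real (\<eta> y) else 0)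
         + (if x = y+1 then (\<psi> y - \<psi> (y+1)) * real (\<eta> (y+1)) else 0))"
    unfolding lin_exchange[OF assms] by (intro sum.cong) (auto simp: Transposition.transpose_def)
  also have "\<dots> = (\<psi> (y+1) - \<psi> y) * real (\<eta> y) + (\<psi> y - \<psi> (y+1)) * real (\<eta> (y+1))"
    using assms unfolding sum.distrib by (simp add: sum.delta) auto
  finally show ?thesis by (simp add: algebra_simps)
qed

lemma lin_upd:
  assumes "z \<in> {1..N}"
  shows "lin c \<psi> (\<eta>(z := v)) - lin c \<psi> \<eta> = \<psi> z * (real v - real (\<eta> z))"
proof -
  have "(\<Sum>x = 1..N. \<psi> x * real ((\<eta>(z := v)) x))
      = (\<Sum>x = 1..N. \<psi> x * real (\<eta> x) + (if x = z then \<psi> z * (real v - real (\<eta> z)) else 0))"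
    by (intro sum.cong) (auto simp: algebra_simps)
  thus ?thesis using assms by (simp add: lin_def sum.distrib)
qed

text \<open>Linear observables are mapped to linear observables: each bond term is linear in the
  occupation numbers because stirring moves occupation values without interaction, and each boundary
  term is affine. This closure is particular to \<open>p = 1/2\<close>.\<close>

lemma gen_lin:
  assumes \<eta>: "\<eta> \<in> Omega N"
  shows "L (lin c \<psi>) \<eta> = lin (\<alpha> * \<psi> 1 + \<delta> * \<psi> N) (walk \<psi>) \<eta>"
proof -
  have "(\<Sum>y = 1..N-1. (lin c \<psi> (exchange y (y+1) \<eta>) - lin c \<psi> \<eta>) / 2)
      = (\<Sum>y = 1..N-1. \<Sum>x = 1..N. (\<psi> (Transposition.transpose y (y+1) x) - \<psi> x) / 2 * real (\<eta> x))"
    by (rule sum.cong[OF refl], subst lin_exchange) (simp_all add: sum_divide_distrib)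
  also have "\<dots> = (\<Sum>x = 1..N. (\<Sum>y = 1..N-1. (\<psi> (Transposition.transpose y (y+1) x) - \<psi> x) / 2) * real (\<eta> x))"
    by (subst sum.swap) (simp add: sum_distrib_right)
  also have "\<dots> = (\<Sum>x = 1..N. walk \<psi> x * real (\<eta> x) + (if x = 1 then (\<alpha> + \<gamma>) * \<psi> 1 * real (\<eta> 1) else 0)
        + (if x = N then (\<beta> + \<delta>) * \<psi> N * real (\<eta> N) else 0))"
    by (intro sum.cong) (auto simp: walk_def algebra_simps)
  also have "\<dots> = (\<Sum>x = 1..N. walk \<psi> x * real (\<eta> x)) + (\<alpha> + \<gamma>) * \<psi> 1 * real (\<eta> 1) + (\<beta> + \<delta>) * \<psi> N * real (\<eta> N)"
    using N2 unfolding sum.distrib by (simp add: sum.delta)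
  finally show ?thesis
    unfolding generator_stirring[OF \<eta>] lin_upd[OF ends(1)] lin_upd[OF ends(2)]
    by (simp add: lin_def algebra_simps)
qed

text \<open>Summation by parts for the symmetric operator \<open>walk\<close>.\<close>

lemma dirichlet_form:
  "(\<Sum>x = 1..N. \<psi> x * walk \<psi> x) = - (\<Sum>y = 1..N-1. (\<psi> (y+1) - \<psi> y)\<^sup>2 / 2)
     - (\<alpha> + \<gamma>) * (\<psi> 1)\<^sup>2 - (\<beta> + \<delta>) * (\<psi> N)\<^sup>2"
proof -
  have "(\<Sum>x = 1..N. \<psi> x * (\<Sum>y = 1..N-1. (\<psi> (Transposition.transpose y (y+1) x) - \<psi> x) / 2))
      = (\<Sum>y = 1..N-1. \<Sum>x = 1..N. \<psi> x * ((\<psi> (Transposition.transpose y (y+1) x) - \<psi> x) / 2))"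
    unfolding sum_distrib_left by (rule sum.swap)
  also have "\<dots> = (\<Sum>y = 1..N-1. - ((\<psi> (y+1) - \<psi> y)\<^sup>2 / 2))"
  proof (rule sum.cong[OF refl])
    fix y assume y: "y \<in> {1..N-1}"
    have "(\<Sum>x = 1..N. \<psi> x * ((\<psi> (Transposition.transpose y (y+1) x) - \<psi> x) / 2))
       = (\<Sum>x = 1..N. (if x = y then \<psi> y * ((\<psi> (y+1) - \<psi> y) / 2) else 0)
         + (if x = y+1 then \<psi> (y+1) * ((\<psi> y - \<psi> (y+1)) / 2) else 0))"
      by (intro sum.cong) (auto simp: Transposition.transpose_def)
    also have "\<dots> = \<psi> y * ((\<psi> (y+1) - \<psi> y) / 2) + \<psi> (y+1) * ((\<psi> y - \<psi> (y+1)) / 2)"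
      using y unfolding sum.distrib by (simp add: sum.delta) auto
    also have "\<dots> = - ((\<psi> (y+1) - \<psi> y)\<^sup>2 / 2)"
      by (simp add: power2_eq_square field_simps)
    finally show "(\<Sum>x = 1..N. \<psi> x * ((\<psi> (Transposition.transpose y (y+1) x) - \<psi> x) / 2))
       = - ((\<psi> (y+1) - \<psi> y)\<^sup>2 / 2)" .
  qed
  finally have 1: "(\<Sum>x = 1..N. \<psi> x * (\<Sum>y = 1..N-1. (\<psi> (Transposition.transpose y (y+1) x) - \<psi> x) / 2))
      = - (\<Sum>y = 1..N-1. (\<psi> (y+1) - \<psi> y)\<^sup>2 / 2)" by (simp add: sum_negf)
  have "(\<Sum>x = 1..N. \<psi> x * walk \<psi> x)
    = (\<Sum>x = 1..N. \<psi> x * (\<Sum>y = 1..N-1. (\<psi> (Transposition.transpose y (y+1) x) - \<psi> x) / 2)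
        - (if x = 1 then (\<alpha> + \<gamma>) * (\<psi> 1)\<^sup>2 else 0) - (if x = N then (\<beta> + \<delta>) * (\<psi> N)\<^sup>2 else 0))"
    unfolding walk_def by (intro sum.cong) (auto simp: algebra_simps power2_eq_square)
  thus ?thesis unfolding sum_subtractf 1 using N2 by (simp add: sum.delta)
qed

text \<open>For a move \<open>\<sigma>\<close> at rate \<open>r\<close>, the left side collects \<open>r (g (\<sigma> \<eta>) - g \<eta>)\<^sup>2\<close>. Since occupation numbers are 0 or 1,
  each increment is bounded by a gradient or a boundary value of \<open>\<psi>\<close>, and these add up to the Dirichlet
  form whatever the configuration is.\<close>

lemma carre_du_champ_lin:
  assumes \<eta>: "\<eta> \<in> Omega N"
  shows "L (\<lambda>\<zeta>. (lin c \<psi> \<zeta>)\<^sup>2) \<eta> - 2 * lin c \<psi> \<eta> * L (lin c \<psi>) \<eta> \<le> - (\<Sum>x = 1..N. \<psi> x * walk \<psi> x)"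
proof -
  let ?g = "lin c \<psi>"
  have v: "real (\<eta> x) = 0 \<or> real (\<eta> x) = 1" if "x \<in> {1..N}" for x
    using Omega_values[OF \<eta> that] by auto
  have bd: "(?g (\<eta>(z := w)) - ?g \<eta>)\<^sup>2 \<le> (\<psi> z)\<^sup>2" if "z \<in> {1..N}" "w \<in> {0, 1}" for z w
    unfolding lin_upd[OF that(1)] using v[OF that(1)] that(2) by auto
  have sq: "r * (a\<^sup>2 - b\<^sup>2) - 2 * b * (r * (a - b)) = r * (a - b)\<^sup>2" for r a b :: real
    by (simp add: power2_eq_square algebra_simps)
  have "L (\<lambda>\<zeta>. (?g \<zeta>)\<^sup>2) \<eta> - 2 * ?g \<eta> * L ?g \<eta>
    = (\<Sum>y = 1..N-1. (?g (exchange y (y+1) \<eta>) - ?g \<eta>)\<^sup>2 / 2)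
    + \<alpha> * (?g (\<eta>(1 := 1)) - ?g \<eta>)\<^sup>2 + \<gamma> * (?g (\<eta>(1 := 0)) - ?g \<eta>)\<^sup>2
    + \<delta> * (?g (\<eta>(N := 1)) - ?g \<eta>)\<^sup>2 + \<beta> * (?g (\<eta>(N := 0)) - ?g \<eta>)\<^sup>2"
    unfolding generator_stirring[OF \<eta>] sq[symmetric]
    using sum_subtractf[of "\<lambda>y. ((?g (exchange y (y+1) \<eta>))\<^sup>2 - (?g \<eta>)\<^sup>2) / 2"
        "\<lambda>y. 2 * ?g \<eta> * ((?g (exchange y (y+1) \<eta>) - ?g \<eta>) / 2)" "{1..N-1}"]
      sum_distrib_left[of "2 * ?g \<eta>" "\<lambda>y. (?g (exchange y (y+1) \<eta>) - ?g \<eta>) / 2" "{1..N-1}"]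
    by (simp add: algebra_simps power2_eq_square diff_divide_distrib add_divide_distrib)
  also have "\<dots> \<le> (\<Sum>y = 1..N-1. (\<psi> (y+1) - \<psi> y)\<^sup>2 / 2) + \<alpha> * (\<psi> 1)\<^sup>2 + \<gamma> * (\<psi> 1)\<^sup>2 + \<delta> * (\<psi> N)\<^sup>2 + \<beta> * (\<psi> N)\<^sup>2"
  proof (intro add_mono sum_mono mult_left_mono nonneg)
    fix y assume y: "y \<in> {1..N-1}"
    hence "y \<in> {1..N}" "y+1 \<in> {1..N}" by auto
    thus "(?g (exchange y (y+1) \<eta>) - ?g \<eta>)\<^sup>2 / 2 \<le> (\<psi> (y+1) - \<psi> y)\<^sup>2 / 2"
      unfolding lin_exchange'[OF y] using v[of y] v[of "y+1"] by (auto simp: power_mult_distrib)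
  qed (intro bd ends; simp)+
  finally show ?thesis unfolding dirichlet_form by (simp add: algebra_simps)
qed

text \<open>The unique affine observable agreeing with a function on the empty and the one-particle
  configurations. Reading off the coefficients in this way gives them an explicit dependence on
  time, which can be differentiated.\<close>

abbreviation affine_part :: "(config \<Rightarrow> real) \<Rightarrow> config \<Rightarrow> real" where
  "affine_part f \<equiv> lin (f (empty_config N)) (\<lambda>x. f ((empty_config N)(x := 1)) - f (empty_config N))"

lemma lin_empty: "lin c \<psi> (empty_config N) = c"
  by (simp add: lin_def empty_config_def)

lemma lin_single: "x \<in> {1..N} \<Longrightarrow> lin c \<psi> ((empty_config N)(x := 1)) - lin c \<psi> (empty_config N) = \<psi> x"
  by (subst lin_upd) (auto simp: empty_config_def)

lemma affine_part_lin: "affine_part (lin c \<psi>) \<eta> = lin c \<psi> \<eta>"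
proof -
  let ?e = "empty_config N"
  have "(\<Sum>x = 1..N. (lin c \<psi> (?e(x := 1)) - lin c \<psi> ?e) * real (\<eta> x)) = (\<Sum>x = 1..N. \<psi> x * real (\<eta> x))"
    by (intro sum.cong refl) (simp only: lin_single)
  thus ?thesis unfolding lin_def[of _ _ \<eta>] by (simp add: lin_empty)
qed

lemma single_in_Omega: "x \<in> {1..N} \<Longrightarrow> (empty_config N)(x := 1) \<in> Omega N"
  by (intro upd_in_Omega) auto

lemma affine_part_cong:
  assumes "\<And>\<zeta>. \<zeta> \<in> Omega N \<Longrightarrow> f \<zeta> = g \<zeta>"
  shows "affine_part f \<eta> = affine_part g \<eta>"
  unfolding lin_def
  by (intro arg_cong2[of _ _ _ _ "(+)"] arg_cong2[of _ _ _ _ "(*)"] arg_cong2[of _ _ _ _ "(-)"]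
      sum.cong refl assms empty_in_Omega single_in_Omega)

lemma semigroup_lin:
  assumes \<eta>: "\<eta> \<in> Omega N"
  shows "P t (lin c \<psi>) \<eta> = affine_part (P t (lin c \<psi>)) \<eta>"
proof -
  let ?F = "lin c \<psi>"
  have ex: "\<exists>c' \<psi>'. \<forall>\<zeta>\<in>Omega N. (L ^^ k) ?F \<zeta> = lin c' \<psi>' \<zeta>" for k
  proof (induction k)
    case (Suc k)
    then obtain c' \<psi>' where "\<forall>\<zeta>\<in>Omega N. (L ^^ k) ?F \<zeta> = lin c' \<psi>' \<zeta>" by blast
    hence "\<forall>\<zeta>\<in>Omega N. (L ^^ Suc k) ?F \<zeta> = lin (\<alpha> * \<psi>' 1 + \<delta> * \<psi>' N) (walk \<psi>') \<zeta>"
      using gen_cong[of "(L ^^ k) ?F" "lin c' \<psi>'"] gen_lin by auto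
    thus ?case by blast
  qed auto
  have k: "affine_part ((L ^^ k) ?F) \<eta> = (L ^^ k) ?F \<eta>" for k
  proof -
    obtain c' \<psi>' where e: "\<And>\<zeta>. \<zeta> \<in> Omega N \<Longrightarrow> (L ^^ k) ?F \<zeta> = lin c' \<psi>' \<zeta>"
      using ex[of k] by auto
    show ?thesis by (rule trans[OF affine_part_cong[OF e] trans[OF affine_part_lin e[OF \<eta>, symmetric]]])
  qed
  have "(\<lambda>k. affine_part (\<lambda>\<zeta>. t ^ k / fact k * (L ^^ k) ?F \<zeta>) \<eta>) sums affine_part (P t ?F) \<eta>"
    unfolding lin_def
    by (intro sums_add sums_sum sums_mult2 sums_diff semigroup_sums[unfolded lin_def] empty_in_Omega single_in_Omega)
  moreover have "affine_part (\<lambda>\<zeta>. t ^ k / fact k * (L ^^ k) ?F \<zeta>) \<eta> = t ^ k / fact k * (L ^^ k) ?F \<eta>" for k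
    unfolding k[symmetric] by (simp add: lin_def[of _ _ \<eta>] algebra_simps sum_distrib_left)
  ultimately show ?thesis using semigroup_sums[OF \<eta>, of t ?F] sums_unique2 by auto
qed

text \<open>Let \<open>\<phi> s\<close> be the coefficients of \<open>P s F\<close>; they evolve by the killed walk, so the derivative of
  \<open>(\<Sum>x. (\<phi> s x)\<^sup>2) / 2\<close> is the negative of the Dirichlet form of \<open>\<phi> s\<close>. By the bound on the carre du champ, this is
  exactly enough to make \<open>(P s F)\<^sup>2 - (\<Sum>x. (\<phi> s x)\<^sup>2) / 2\<close> a supersolution of the backward
  equation, and the comparison principle gives the claim. The bound is uniform in time and in the
  starting configuration.\<close>

lemma variance_lin:
  assumes \<eta>: "\<eta> \<in> Omega N" and t: "0 \<le> t"
  shows "P t (\<lambda>\<zeta>. (lin c \<psi> \<zeta>)\<^sup>2) \<eta> - (P t (lin c \<psi>) \<eta>)\<^sup>2 \<le> (\<Sum>x = 1..N. (\<psi> x)\<^sup>2) / 2"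
proof -
  let ?F = "lin c \<psi>" and ?e = "empty_config N"
  define \<phi> where "\<phi> s x = P s ?F (?e(x := 1)) - P s ?F ?e" for s x
  have lin: "P s ?F \<zeta> = lin (P s ?F ?e) (\<phi> s) \<zeta>" if "\<zeta> \<in> Omega N" for s \<zeta>
    using semigroup_lin[OF that] unfolding \<phi>_def .
  have Llin: "L (P s ?F) \<zeta> = lin (\<alpha> * \<phi> s 1 + \<delta> * \<phi> s N) (walk (\<phi> s)) \<zeta>" if "\<zeta> \<in> Omega N" for s \<zeta>
    using gen_cong[OF lin that] gen_lin[OF that] by simp
  have \<phi>': "((\<lambda>s. \<phi> s x) has_real_derivative walk (\<phi> s) x) (at s)" if "x \<in> {1..N}" for s x
    unfolding \<phi>_def[of _ x]
    by (rule DERIV_cong[OF DERIV_diff[OF semigroup_deriv semigroup_deriv]])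
      (use that in \<open>simp_all add: single_in_Omega Llin lin_single del: One_nat_def\<close>)
  define u where "u s \<zeta> = (P s ?F \<zeta>)\<^sup>2 - (\<Sum>x = 1..N. (\<phi> s x)\<^sup>2) / 2" for s \<zeta>
  define u' where "u' s \<zeta> = 2 * P s ?F \<zeta> * L (P s ?F) \<zeta> - (\<Sum>x = 1..N. \<phi> s x * walk (\<phi> s) x)" for s \<zeta>
  have le: "P t (u 0) \<eta> \<le> u t \<eta>"
  proof (rule comparison[OF _ _ \<eta> t])
    fix s \<zeta> assume \<zeta>: "\<zeta> \<in> Omega N"
    have "((\<lambda>s. \<Sum>x = 1..N. (\<phi> s x)\<^sup>2) has_real_derivative (\<Sum>x = 1..N. 2 * (\<phi> s x * walk (\<phi> s) x))) (at s)"
      by (rule DERIV_sum, rule DERIV_cong[OF DERIV_power[OF \<phi>']]) auto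
    from DERIV_diff[OF DERIV_power[OF semigroup_deriv[OF \<zeta>, of ?F s], of 2] DERIV_cdivide[OF this, of 2]]
    show "((\<lambda>s. u s \<zeta>) has_real_derivative u' s \<zeta>) (at s)"
      unfolding u_def u'_def by (rule DERIV_cong) (simp flip: sum_distrib_left)
    have "L (u s) \<zeta> = L (\<lambda>\<zeta>. (P s ?F \<zeta>)\<^sup>2) \<zeta>"
      using gen_add[of "\<lambda>\<zeta>. (P s ?F \<zeta>)\<^sup>2" "\<lambda>_. - ((\<Sum>x = 1..N. (\<phi> s x)\<^sup>2) / 2)" \<zeta>]
      by (simp add: u_def[abs_def] gen_const)
    also have "\<dots> = L (\<lambda>\<zeta>. (lin (P s ?F ?e) (\<phi> s) \<zeta>)\<^sup>2) \<zeta>"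
      by (rule gen_cong[OF _ \<zeta>]) (simp only: lin[symmetric])
    also have "\<dots> \<le> u' s \<zeta>"
      using carre_du_champ_lin[OF \<zeta>, of "P s ?F ?e" "\<phi> s"]
      by (simp add: u'_def lin[OF \<zeta>, symmetric] Llin[OF \<zeta>] gen_lin[OF \<zeta>])
    finally show "L (u s) \<zeta> \<le> u' s \<zeta>" .
  qed
  have \<phi>0: "\<phi> 0 x = \<psi> x" if "x \<in> {1..N}" for x
    unfolding \<phi>_def semigroup_zero[OF single_in_Omega[OF that]] semigroup_zero[OF empty_in_Omega]
    by (rule lin_single[OF that])
  have "(\<Sum>x = 1..N. (\<phi> 0 x)\<^sup>2) = (\<Sum>x = 1..N. (\<psi> x)\<^sup>2)"
    by (intro sum.cong refl) (simp only: \<phi>0)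
  hence "P t (u 0) \<eta> = P t (\<lambda>\<zeta>. (?F \<zeta>)\<^sup>2 - (\<Sum>x = 1..N. (\<psi> x)\<^sup>2) / 2) \<eta>"
    by (intro semigroup_cong[OF _ \<eta>]) (simp add: u_def semigroup_zero)
  moreover have "0 \<le> (\<Sum>x = 1..N. (\<phi> t x)\<^sup>2)" by (intro sum_nonneg) auto
  ultimately show ?thesis using le by (simp add: u_def[of t] semigroup_diff \<eta> semigroup_const)
qed

end

section \<open>Total variation distance\<close>

lemma tv_dist_positive_part:
  assumes "(\<Sum>x\<in>Omega N. p x) = (\<Sum>x\<in>Omega N. q x)"
  shows "tv_dist N p q = (\<Sum>x\<in>{x \<in> Omega N. q x < p x}. p x - q x)"
proof -
  let ?S = "{x \<in> Omega N. q x < p x}"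
  have s: "(\<Sum>x\<in>Omega N. f x) = (\<Sum>x\<in>?S. f x) + (\<Sum>x\<in>Omega N - ?S. f x)" for f :: "config \<Rightarrow> real"
    by (subst sum.subset_diff[of ?S "Omega N"]) auto
  have "(\<Sum>x\<in>?S. \<bar>p x - q x\<bar>) = (\<Sum>x\<in>?S. p x - q x)"
    by (intro sum.cong) auto
  moreover have "(\<Sum>x\<in>Omega N - ?S. \<bar>p x - q x\<bar>) = - (\<Sum>x\<in>Omega N - ?S. p x - q x)"
    unfolding sum_negf[symmetric] by (intro sum.cong) auto
  moreover have "(\<Sum>x\<in>?S. p x - q x) + (\<Sum>x\<in>Omega N - ?S. p x - q x) = 0"
    using s[of "\<lambda>x. p x - q x"] assms by (simp add: sum_subtractf)
  ultimately show ?thesis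
    unfolding tv_dist_def s[of "\<lambda>x. \<bar>p x - q x\<bar>"] by simp
qed

text \<open>Two laws with distant means and small variances barely overlap. For each point \<open>F\<close> is far from
  one of the two means, so the overlap \<open>min p q\<close>, weighted with the sum of both squared distances,
  costs at least \<open>d\<^sup>2 / 2\<close> per unit mass, whereas its total cost is at most the sum of the variances.\<close>

lemma tv_dist_second_moment:
  fixes F :: "config \<Rightarrow> real"
  assumes p: "\<And>x. x \<in> Omega N \<Longrightarrow> 0 \<le> p x" "(\<Sum>x\<in>Omega N. p x) = 1"
    and q: "\<And>x. x \<in> Omega N \<Longrightarrow> 0 \<le> q x" "(\<Sum>x\<in>Omega N. q x) = 1"
    and mp: "(\<Sum>x\<in>Omega N. p x * F x) = a" and mq: "(\<Sum>x\<in>Omega N. q x * F x) = b"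
    and vp: "(\<Sum>x\<in>Omega N. p x * (F x)\<^sup>2) - a\<^sup>2 \<le> V" and vq: "(\<Sum>x\<in>Omega N. q x * (F x)\<^sup>2) - b\<^sup>2 \<le> V"
    and d: "0 < d" "d \<le> \<bar>a - b\<bar>"
  shows "1 - 4 * V / d\<^sup>2 \<le> tv_dist N p q"
proof -
  have var: "(\<Sum>x\<in>Omega N. r x * (F x - c)\<^sup>2) = (\<Sum>x\<in>Omega N. r x * (F x)\<^sup>2) - c\<^sup>2"
    if "(\<Sum>x\<in>Omega N. r x) = 1" "(\<Sum>x\<in>Omega N. r x * F x) = c" for r c
  proof -
    have "(\<Sum>x\<in>Omega N. r x * (F x - c)\<^sup>2)
        = (\<Sum>x\<in>Omega N. r x * (F x)\<^sup>2 - 2 * c * (r x * F x) + c\<^sup>2 * r x)"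
      by (intro sum.cong refl) (simp add: power2_eq_square algebra_simps)
    also have "\<dots>
        = (\<Sum>x\<in>Omega N. r x * (F x)\<^sup>2) - 2 * c * (\<Sum>x\<in>Omega N. r x * F x) + c\<^sup>2 * (\<Sum>x\<in>Omega N. r x)"
      unfolding sum.distrib sum_subtractf sum_distrib_left ..
    finally have "(\<Sum>x\<in>Omega N. r x * (F x - c)\<^sup>2)
        = (\<Sum>x\<in>Omega N. r x * (F x)\<^sup>2) - 2 * c * (\<Sum>x\<in>Omega N. r x * F x) + c\<^sup>2 * (\<Sum>x\<in>Omega N. r x)" .
    thus ?thesis using that by (simp add: power2_eq_square)
  qed
  \<comment> \<open>The sum of the squared distances to two points is smallest at their midpoint.\<close>
  have sq: "d\<^sup>2 / 2 \<le> (y - a)\<^sup>2 + (y - b)\<^sup>2" for y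
  proof -
    have "d\<^sup>2 \<le> (a - b)\<^sup>2" using d by (metis abs_le_square_iff abs_of_pos)
    moreover have "(y - a)\<^sup>2 + (y - b)\<^sup>2 = (a - b)\<^sup>2 / 2 + 2 * (y - (a + b) / 2)\<^sup>2"
      by (simp add: power2_eq_square field_simps)
    ultimately show ?thesis using zero_le_power2[of "y - (a + b) / 2"] by linarith
  qed
  have "(\<Sum>x\<in>Omega N. min (p x) (q x)) * (d\<^sup>2 / 2) = (\<Sum>x\<in>Omega N. min (p x) (q x) * (d\<^sup>2 / 2))"
    by (simp add: sum_distrib_right)
  also have "\<dots> \<le> (\<Sum>x\<in>Omega N. p x * (F x - a)\<^sup>2 + q x * (F x - b)\<^sup>2)"
  proof (rule sum_mono)
    fix x assume x: "x \<in> Omega N"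
    have "min (p x) (q x) * (d\<^sup>2 / 2) \<le> min (p x) (q x) * ((F x - a)\<^sup>2 + (F x - b)\<^sup>2)"
      using p(1)[OF x] q(1)[OF x] by (intro mult_left_mono sq) auto
    also have "\<dots> \<le> p x * (F x - a)\<^sup>2 + q x * (F x - b)\<^sup>2"
      unfolding distrib_left by (intro add_mono mult_right_mono) auto
    finally show "min (p x) (q x) * (d\<^sup>2 / 2) \<le> p x * (F x - a)\<^sup>2 + q x * (F x - b)\<^sup>2" .
  qed
  also have "\<dots> \<le> 2 * V"
    unfolding sum.distrib var[OF p(2) mp] var[OF q(2) mq] using vp vq by simp
  finally have "(\<Sum>x\<in>Omega N. min (p x) (q x)) \<le> 4 * V / d\<^sup>2"
    using d by (simp add: field_simps)
  moreover have "tv_dist N p q = 1 - (\<Sum>x\<in>Omega N. min (p x) (q x))"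
  proof -
    have "(\<Sum>x\<in>Omega N. \<bar>p x - q x\<bar>) = (\<Sum>x\<in>Omega N. p x + q x - 2 * min (p x) (q x))"
      by (intro sum.cong) auto
    thus ?thesis
      using p q by (simp add: tv_dist_def sum.distrib sum_subtractf sum_distrib_left[symmetric])
  qed
  ultimately show ?thesis by simp
qed

section \<open>Exponential relaxation and the stationary distribution\<close>

text \<open>The arguments are the total reset rates of the two boundary sites. The stronger reservoir
  governs relaxation, and \<open>1 / max a b\<close> is the price of its being slow: a discrepancy has to spend
  about that much time at the boundary before it is removed.\<close>

definition relax_const :: "real \<Rightarrow> real \<Rightarrow> real" where
  "relax_const a b = 1 + 1 / max a b"

lemma square_gap_step: "(2 * n * (y + 1) - (y + 1)\<^sup>2) - (2 * n * y - y\<^sup>2) = 2 * n - 2 * y - (1::real)"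
  by (simp add: power2_eq_square algebra_simps)

locale ergodic_ssep = open_ssep +
  assumes reservoir: "0 < max (\<alpha> + \<gamma>) (\<beta> + \<delta>)"
begin

abbreviation "K \<equiv> relax_const (\<alpha> + \<gamma>) (\<beta> + \<delta>)"

lemma K_ge_1: "1 \<le> K"
  using reservoir by (simp add: relax_const_def)

text \<open>A Lyapunov function for the killed walk, comparable to its expected lifetime. Next to an absorbing boundary at
  the left and a reflecting one at the right, \<open>2 N x - x\<^sup>2\<close> decreases in mean at rate 1 in the bulk;
  adding \<open>N / a\<close> makes killing at rate \<open>a\<close> outweigh the upward drift at site 1. At the opposite end
  the increment is exactly 1, which leaves \<open>- 1/2\<close> and explains the constant. When the right
  reservoir is the stronger one, the function is reflected.\<close>

lemma killing_barrier:
  obtains h where "\<And>x. x \<in> {1..N} \<Longrightarrow> 1 \<le> h x" "\<And>x. x \<in> {1..N} \<Longrightarrow> h x \<le> K * real N ^ 2"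
    "\<And>x. x \<in> {1..N} \<Longrightarrow> walk h x \<le> - (1/2)"
proof -
  define a where "a = max (\<alpha> + \<gamma>) (\<beta> + \<delta>)"
  define n where "n = real N"
  have a: "0 < a" using reservoir by (simp add: a_def)
  have n: "2 \<le> n" using N2 by (simp add: n_def)
  define q where "q y = n / a + (2 * n * y - y\<^sup>2)" for y
  have q_ge: "1 \<le> q y" and q_le: "q y \<le> K * n\<^sup>2" if "1 \<le> y" "y \<le> n" for y
  proof -
    have "0 \<le> (y - 1) * (2 * n - 1 - y)" using that by (intro mult_nonneg_nonneg) auto
    hence "2 * n - 1 \<le> 2 * n * y - y\<^sup>2" by (simp add: power2_eq_square algebra_simps)
    moreover have "0 \<le> n / a" using n a by simp
    ultimately show "1 \<le> q y" unfolding q_def using n by linarith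
    have "0 \<le> (n - y)\<^sup>2" by simp
    hence "2 * n * y - y\<^sup>2 \<le> n\<^sup>2" by (simp add: power2_eq_square algebra_simps)
    moreover have "n / a \<le> n\<^sup>2 / a" using n a by (intro divide_right_mono) (auto simp: power2_eq_square)
    moreover have "K * n\<^sup>2 = n\<^sup>2 + n\<^sup>2 / a" by (simp add: relax_const_def a_def algebra_simps)
    ultimately show "q y \<le> K * n\<^sup>2" unfolding q_def by linarith
  qed
  have q1: "a * q 1 \<ge> n"
  proof -
    have "a * q 1 = n + a * (2 * n - 1)" using a by (simp add: q_def field_simps)
    moreover have "0 \<le> a * (2 * n - 1)" using a n by (intro mult_nonneg_nonneg) auto
    ultimately show ?thesis by linarith
  qed
  have step: "q (y + 1) - q y = 2 * n - 2 * y - 1" for y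
    unfolding q_def using square_gap_step[of n y] by simp
  have q2: "q 2 - q 1 = 2 * n - 3" using step[of 1] by simp
  have nn: "0 \<le> \<alpha> + \<gamma>" "0 \<le> \<beta> + \<delta>" using nonneg by auto
  have mid: "(q (y + 1) - q y) / 2 + (q (y - 1) - q y) / 2 = - 1" for y
  proof -
    have "q y - q (y - 1) = 2 * n - 2 * (y - 1) - 1" using step[of "y - 1"] by simp
    thus ?thesis using step[of y] by argo
  qed
  show ?thesis
  proof (cases "\<beta> + \<delta> \<le> \<alpha> + \<gamma>")
    case True
    hence aa: "a = \<alpha> + \<gamma>" by (simp add: a_def)
    show ?thesis
    proof (rule that[of "\<lambda>x. q (real x)"])
      fix x assume x: "x \<in> {1..N}"
      hence x': "1 \<le> real x" "real x \<le> n" by (auto simp: n_def)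
      show "1 \<le> q (real x)" "q (real x) \<le> K * real N ^ 2"
        using q_ge[OF x'] q_le[OF x'] by (simp_all add: n_def)
      have "q (real x) \<ge> 0" using q_ge[OF x'] by simp
      hence b: "0 \<le> (\<beta> + \<delta>) * q (real x)" using nn by simp
      consider "x = 1" | "1 < x" "x < N" | "x = N" "1 < x" using x N2 by force
      thus "walk (\<lambda>x. q (real x)) x \<le> - (1/2)"
      proof cases
        case 1
        have "walk (\<lambda>x. q (real x)) x = (q 2 - q 1) / 2 - a * q 1"
          unfolding walk_steps[OF x] using 1 N2 aa by simp
        thus ?thesis using q2 q1 by argo
      next
        case 2
        have "walk (\<lambda>x. q (real x)) x = (q (real x + 1) - q (real x)) / 2 + (q (real x - 1) - q (real x)) / 2"
          unfolding walk_steps[OF x] using 2 by (simp add: of_nat_diff add.commute)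
        thus ?thesis using mid[of "real x"] by argo
      next
        case 3
        have "walk (\<lambda>x. q (real x)) x = (q (real x - 1) - q (real x - 1 + 1)) / 2 - (\<beta> + \<delta>) * q (real x)"
          unfolding walk_steps[OF x] using 3 by (simp add: of_nat_diff)
        thus ?thesis using step[of "real x - 1"] b x'(2) by argo
      qed
    qed
  next
    case False
    hence aa: "a = \<beta> + \<delta>" by (simp add: a_def)
    show ?thesis
    proof (rule that[of "\<lambda>x. q (n + 1 - real x)"])
      fix x assume x: "x \<in> {1..N}"
      hence x': "1 \<le> n + 1 - real x" "n + 1 - real x \<le> n" by (auto simp: n_def)
      show "1 \<le> q (n + 1 - real x)" "q (n + 1 - real x) \<le> K * real N ^ 2"
        using q_ge[OF x'] q_le[OF x'] by (simp_all add: n_def)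
      have "q (n + 1 - real x) \<ge> 0" using q_ge[OF x'] by simp
      hence b: "0 \<le> (\<alpha> + \<gamma>) * q (n + 1 - real x)" using nn by simp
      consider "x = N" | "1 < x" "x < N" | "x = 1" "x < N" using x N2 by force
      thus "walk (\<lambda>x. q (n + 1 - real x)) x \<le> - (1/2)"
      proof cases
        case 1
        have "walk (\<lambda>x. q (n + 1 - real x)) x = (q 2 - q 1) / 2 - a * q 1"
          unfolding walk_steps[OF x] using 1 N2 aa by (simp add: n_def of_nat_diff)
        thus ?thesis using q2 q1 by argo
      next
        case 2
        let ?y = "n + 1 - real x"
        have "walk (\<lambda>x. q (n + 1 - real x)) x = (q (?y - 1) - q ?y) / 2 + (q (?y + 1) - q ?y) / 2"
          unfolding walk_steps[OF x] using 2 by (simp add: of_nat_diff algebra_simps)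
        thus ?thesis using mid[of ?y] by argo
      next
        case 3
        have "walk (\<lambda>x. q (n + 1 - real x)) x = (q (n - 1) - q (n - 1 + 1)) / 2 - (\<alpha> + \<gamma>) * q (n + 1 - real x)"
          unfolding walk_steps[OF x] using 3 by simp
        thus ?thesis using step[of "n - 1"] b by argo
      qed
    qed
  qed
qed

text \<open>The barrier loses at least \<open>1/2\<close> per unit time and is at most \<open>K N\<^sup>2\<close>, so relative to its size it
  decays at this rate.\<close>

definition \<kappa> :: real where
  "\<kappa> = 1 / (2 * K * real N ^ 2)"

lemma \<kappa>_pos: "0 < \<kappa>"
  using K_ge_1 N2 by (simp add: \<kappa>_def)

lemma \<kappa>_le_total_rate: "\<kappa> \<le> total_rate"
proof -
  have "1 \<le> K * real N ^ 2"
    using mult_mono[of 1 K 1 "real N ^ 2"] K_ge_1 N2 by simp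
  hence "\<kappa> \<le> 1 / 2" by (simp add: \<kappa>_def field_simps)
  also have "\<dots> \<le> total_rate"
  proof -
    have "1 \<le> real (N - 1)" using N2 by linarith
    thus ?thesis using nonneg unfolding total_rate_def by linarith
  qed
  finally show ?thesis .
qed

text \<open>A function bounded by \<open>B\<close> changes by at most \<open>2 B\<close> at a flip, hence by at most \<open>2 B\<close> times the
  barrier. Summing the decayed barrier over the \<open>N\<close> sites costs \<open>K N\<^sup>3\<close>; comparing two configurations through the
  empty one costs another factor 2.\<close>

lemma oscillation_decay:
  assumes f: "\<And>\<zeta>. \<zeta> \<in> Omega N \<Longrightarrow> \<bar>f \<zeta>\<bar> \<le> B" and t: "0 \<le> t"
    and \<eta>: "\<eta> \<in> Omega N" and \<xi>: "\<xi> \<in> Omega N"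
  shows "\<bar>P t f \<eta> - P t f \<xi>\<bar> \<le> 4 * B * K * real N ^ 3 * exp (- \<kappa> * t)"
proof -
  obtain h where h1: "\<And>x. x \<in> {1..N} \<Longrightarrow> 1 \<le> h x"
    and hK: "\<And>x. x \<in> {1..N} \<Longrightarrow> h x \<le> K * real N ^ 2"
    and Ah: "\<And>x. x \<in> {1..N} \<Longrightarrow> walk h x \<le> - (1/2)"
    by (rule killing_barrier) blast
  have B: "0 \<le> B" using f[OF \<eta>] by linarith
  have KN: "0 < K * real N ^ 2" using K_ge_1 N2 by simp
  have low: "- (2 * B * K * real N ^ 3 * exp (- \<kappa> * t)) \<le> P t g \<zeta> - P t g (empty_config N)"
    if g: "\<And>\<zeta>. \<zeta> \<in> Omega N \<Longrightarrow> \<bar>g \<zeta>\<bar> \<le> B" and \<zeta>: "\<zeta> \<in> Omega N" for g \<zeta>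
  proof -
    have "grad_ge g (\<lambda>x. - (2 * B) * h x)"
      unfolding grad_ge_def
    proof (intro ballI impI)
      fix \<eta> x assume a: "\<eta> \<in> Omega N" "x \<in> {1..N}" "\<eta> x = 0"
      have "\<eta>(x := 1) \<in> Omega N" by (intro upd_in_Omega a) auto
      from g[OF this] g[OF a(1)] have "- (2 * B) \<le> g (\<eta>(x := 1)) - g \<eta>" by linarith
      moreover have "2 * B * 1 \<le> 2 * B * h x" using B h1[OF a(2)] by (intro mult_left_mono) auto
      ultimately show "- (2 * B) * h x \<le> g (\<eta>(x := 1)) - g \<eta>" by simp
    qed
    moreover have "- (\<kappa> * (- (2 * B) * h x)) \<le> walk (\<lambda>x. - (2 * B) * h x) x" if x: "x \<in> {1..N}" for x
    proof -
      have "\<kappa> * h x \<le> \<kappa> * (K * real N ^ 2)" using \<kappa>_pos hK[OF x] by (intro mult_left_mono) auto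
      also have "\<dots> = 1 / 2" using K_ge_1 N2 by (auto simp: \<kappa>_def)
      finally have "2 * B * (\<kappa> * h x) \<le> 2 * B * (- walk h x)" using B Ah[OF x] by (intro mult_left_mono) auto
      moreover have "- (\<kappa> * (- (2 * B) * h x)) = 2 * B * (\<kappa> * h x)" by simp
      moreover have "walk (\<lambda>x. - (2 * B) * h x) x = 2 * B * - walk h x" using walk_cmult[of "- (2 * B)" h x] by simp
      ultimately show ?thesis by linarith
    qed
    ultimately have "grad_ge (P t g) (\<lambda>x. exp (- \<kappa> * t) * (- (2 * B) * h x))"
      using \<kappa>_le_total_rate t by (rule gradient_decay)
    from gradient_total[OF this \<zeta>]
    have "(\<Sum>x = 1..N. exp (- \<kappa> * t) * (- (2 * B) * h x) * real (\<zeta> x)) \<le> P t g \<zeta> - P t g (empty_config N)" .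
    moreover have "(\<Sum>x = 1..N. - (exp (- \<kappa> * t) * (2 * B * (K * real N ^ 2))))
        \<le> (\<Sum>x = 1..N. exp (- \<kappa> * t) * (- (2 * B) * h x) * real (\<zeta> x))"
    proof (rule sum_mono)
      fix x assume x: "x \<in> {1..N}"
      have "exp (- \<kappa> * t) * (2 * B * (h x * real (\<zeta> x))) \<le> exp (- \<kappa> * t) * (2 * B * (K * real N ^ 2))"
        using Omega_values[OF \<zeta> x] hK[OF x] KN B by (intro mult_left_mono) auto
      thus "- (exp (- \<kappa> * t) * (2 * B * (K * real N ^ 2))) \<le> exp (- \<kappa> * t) * (- (2 * B) * h x) * real (\<zeta> x)"
        by (simp add: mult_ac)
    qed
    moreover have "(\<Sum>x = 1..N. - (exp (- \<kappa> * t) * (2 * B * (K * real N ^ 2))))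
        = - (2 * B * K * real N ^ 3 * exp (- \<kappa> * t))"
      by (simp add: power3_eq_cube power2_eq_square)
    ultimately show ?thesis by linarith
  qed
  have "\<bar>P t f \<zeta> - P t f (empty_config N)\<bar> \<le> 2 * B * K * real N ^ 3 * exp (- \<kappa> * t)"
    if "\<zeta> \<in> Omega N" for \<zeta>
    using low[of f, OF f that] low[of "\<lambda>\<zeta>. - f \<zeta>", OF _ that] f that by (simp add: semigroup_uminus)
  from this[OF \<eta>] this[OF \<xi>] show ?thesis by (simp add: abs_le_iff)
qed

lemma bounded_on_Omega: obtains B where "\<And>\<zeta>. \<zeta> \<in> Omega N \<Longrightarrow> \<bar>f \<zeta>\<bar> \<le> (B :: real)"
  using that[of "\<Sum>\<zeta>\<in>Omega N. \<bar>f \<zeta>\<bar>"] member_le_sum[of _ "Omega N" "\<lambda>\<zeta>. \<bar>f \<zeta>\<bar>"] by auto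

lemma exp_decay_tendsto: "(\<lambda>n. c * exp (- \<kappa> * real n)) \<longlonglongrightarrow> 0"
proof -
  have "(\<lambda>n. c * exp (- \<kappa>) ^ n) \<longlonglongrightarrow> c * 0"
    using \<kappa>_pos by (intro tendsto_intros LIMSEQ_realpow_zero) auto
  thus ?thesis by (simp add: exp_of_nat_mult[symmetric] mult_ac)
qed

text \<open>The value of \<open>P m f\<close> is an average of values of \<open>P n f\<close> for \<open>n \<le> m\<close>, so the sequence is Cauchy
  once the oscillation tends to 0, and the limit cannot depend on the starting configuration.\<close>

lemma semigroup_convergent: "\<exists>l. \<forall>\<eta>\<in>Omega N. (\<lambda>n. P (real n) f \<eta>) \<longlonglongrightarrow> l"
proof -
  obtain B where B: "\<And>\<zeta>. \<zeta> \<in> Omega N \<Longrightarrow> \<bar>f \<zeta>\<bar> \<le> B" by (rule bounded_on_Omega[of f]) blast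
  let ?e = "empty_config N"
  define a where "a n = 4 * B * K * real N ^ 3 * exp (- \<kappa> * real n)" for n
  have a: "a \<longlonglongrightarrow> 0" unfolding a_def by (rule exp_decay_tendsto)
  have osc: "\<bar>P (real n) f \<eta> - P (real n) f \<xi>\<bar> \<le> a n" if "\<eta> \<in> Omega N" "\<xi> \<in> Omega N" for n \<eta> \<xi>
    unfolding a_def by (rule oscillation_decay) (use B that in auto)
  have step: "\<bar>P (real m) f ?e - P (real n) f ?e\<bar> \<le> a n" if "n \<le> m" for m n
  proof -
    let ?g = "P (real n) f"
    have "P (real m) f ?e = P (real (m - n)) ?g ?e"
      using that by (simp add: semigroup_semigroup of_nat_diff)
    moreover have "P (real (m - n)) ?g ?e \<le> P (real (m - n)) (\<lambda>_. ?g ?e + a n) ?e"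
      by (rule semigroup_mono) (use osc[OF _ empty_in_Omega, of _ n] in \<open>force simp: abs_le_iff\<close>)+
    moreover have "P (real (m - n)) (\<lambda>_. ?g ?e - a n) ?e \<le> P (real (m - n)) ?g ?e"
      by (rule semigroup_mono) (use osc[OF _ empty_in_Omega, of _ n] in \<open>force simp: abs_le_iff\<close>)+
    ultimately show ?thesis by (simp add: semigroup_const abs_le_iff)
  qed
  have "Cauchy (\<lambda>n. P (real n) f ?e)"
  proof (rule CauchyI)
    fix r :: real assume "0 < r"
    then obtain k where k: "\<bar>a k\<bar> < r / 2"
      using LIMSEQ_D[OF a, of "r / 2"] by auto
    have "norm (P (real m) f ?e - P (real n) f ?e) < r" if "k \<le> m" "k \<le> n" for m n
      using step[OF that(1)] step[OF that(2)] k by (simp add: abs_le_iff abs_less_iff)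
    thus "\<exists>k. \<forall>m\<ge>k. \<forall>n\<ge>k. norm (P (real m) f ?e - P (real n) f ?e) < r" by blast
  qed
  then obtain l where l: "(\<lambda>n. P (real n) f ?e) \<longlonglongrightarrow> l"
    using real_Cauchy_convergent convergent_def by blast
  have "(\<lambda>n. P (real n) f \<eta>) \<longlonglongrightarrow> l" if "\<eta> \<in> Omega N" for \<eta>
  proof -
    have "(\<lambda>n. P (real n) f \<eta> - P (real n) f ?e) \<longlonglongrightarrow> 0"
      by (rule Lim_null_comparison[OF _ a]) (simp add: osc that)
    from tendsto_add[OF this l] show ?thesis by simp
  qed
  thus ?thesis by blast
qed

abbreviation "stationary \<equiv> sep_stationary (1/2) \<alpha> \<beta> \<gamma> \<delta> N"
abbreviation "p \<equiv> sep_transition (1/2) \<alpha> \<beta> \<gamma> \<delta> N"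
abbreviation "\<mu> \<equiv> sep_mu (1/2) \<alpha> \<beta> \<gamma> \<delta> N"

lemma expectation_p: "\<eta> \<in> Omega N \<Longrightarrow> P t f \<eta> = (\<Sum>\<xi>\<in>Omega N. p t \<eta> \<xi> * f \<xi>)"
  unfolding sep_transition_def by (rule semigroup_transition)

lemma p_nonneg: "\<eta> \<in> Omega N \<Longrightarrow> 0 \<le> t \<Longrightarrow> 0 \<le> p t \<eta> \<xi>"
  unfolding sep_transition_def by (intro semigroup_nonneg) auto

lemma p_sum: "\<eta> \<in> Omega N \<Longrightarrow> (\<Sum>\<xi>\<in>Omega N. p t \<eta> \<xi>) = 1"
  using expectation_p[of \<eta> t "\<lambda>_. 1"] by (simp add: semigroup_const)

text \<open>The limits of the transition probabilities are the weights of a law. It is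
  invariant because \<open>P n (P t f)\<close> equals \<open>P t (P n f)\<close>, and here the inner function converges to a constant.\<close>

lemma stationary_exists: "\<exists>\<nu>. stationary \<nu>"
proof -
  let ?e = "empty_config N"
  obtain m where m: "\<And>f \<eta>. \<eta> \<in> Omega N \<Longrightarrow> (\<lambda>n. P (real n) f \<eta>) \<longlonglongrightarrow> m f"
    using semigroup_convergent by metis
  define w where "w \<xi> = (if \<xi> \<in> Omega N then m (indicator {\<xi>}) else 0)" for \<xi>
  have w: "(\<Sum>\<xi>\<in>Omega N. w \<xi> * f \<xi>) = m f" for f
  proof -
    have "(\<lambda>n. \<Sum>\<xi>\<in>Omega N. P (real n) (indicator {\<xi>}) ?e * f \<xi>) \<longlonglongrightarrow> (\<Sum>\<xi>\<in>Omega N. w \<xi> * f \<xi>)"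
      by (intro tendsto_intros) (simp add: w_def m)
    hence "(\<lambda>n. P (real n) f ?e) \<longlonglongrightarrow> (\<Sum>\<xi>\<in>Omega N. w \<xi> * f \<xi>)"
      by (simp add: semigroup_transition[of ?e _ f])
    thus ?thesis using m[OF empty_in_Omega, of f] LIMSEQ_unique by blast
  qed
  have w0: "0 \<le> w \<xi>" for \<xi>
    unfolding w_def
    by (auto intro!: LIMSEQ_le_const[OF m[OF empty_in_Omega]] exI[of _ 0] semigroup_nonneg)
  have "m (\<lambda>_. 1) = 1"
    using m[OF empty_in_Omega, of "\<lambda>_. 1"] by (simp add: semigroup_const LIMSEQ_const_iff)
  with w[of "\<lambda>_. 1"] have w1: "(\<Sum>\<xi>\<in>Omega N. w \<xi>) = 1" by simp
  have "(\<integral>\<^sup>+ x. ennreal (w x) \<partial>count_space UNIV) = (\<Sum>x\<in>Omega N. ennreal (w x))"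
    by (rule nn_integral_count_space') (auto simp: w_def)
  also have "\<dots> = 1" by (simp add: sum_ennreal w0 w1)
  finally have pw: "pmf (embed_pmf w) \<xi> = w \<xi>" for \<xi>
    by (intro pmf_embed_pmf w0)
  have inv: "m (P t f) = m f" if t: "0 \<le> t" for t f
  proof -
    have "P (real n) (P t f) ?e = (\<Sum>\<xi>\<in>Omega N. P t (indicator {\<xi>}) ?e * P (real n) f \<xi>)" for n
      using semigroup_semigroup[of ?e t "real n" f] semigroup_semigroup[of ?e "real n" t f] t
      by (simp add: add.commute semigroup_transition[of ?e t "P (real n) f", symmetric])
    moreover have "(\<lambda>n. \<Sum>\<xi>\<in>Omega N. P t (indicator {\<xi>}) ?e * P (real n) f \<xi>)
        \<longlonglongrightarrow> (\<Sum>\<xi>\<in>Omega N. P t (indicator {\<xi>}) ?e * m f)"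
      by (intro tendsto_intros m)
    moreover have "(\<Sum>\<xi>\<in>Omega N. P t (indicator {\<xi>}) ?e * m f) = m f"
      using semigroup_transition[of ?e t "\<lambda>_. m f"] by (simp add: semigroup_const)
    ultimately have "(\<lambda>n. P (real n) (P t f) ?e) \<longlonglongrightarrow> m f" by simp
    thus ?thesis using m[OF empty_in_Omega, of "P t f"] LIMSEQ_unique by blast
  qed
  have "stationary (embed_pmf w)"
    unfolding sep_stationary_def
  proof (intro conjI allI impI ballI)
    show "set_pmf (embed_pmf w) \<subseteq> Omega N"
      by (auto simp: set_pmf_iff pw w_def split: if_splits)
    fix t :: real and \<xi> assume t: "0 \<le> t" and \<xi>: "\<xi> \<in> Omega N"
    show "(\<Sum>\<eta>\<in>Omega N. pmf (embed_pmf w) \<eta> * p t \<eta> \<xi>) = pmf (embed_pmf w) \<xi>"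
      using w[of "P t (indicator {\<xi>})"] inv[OF t] \<xi> by (simp add: pw sep_transition_def w_def)
  qed
  thus ?thesis by blast
qed

lemma stationary_expectation:
  assumes "stationary \<nu>" "0 \<le> t"
  shows "(\<Sum>\<eta>\<in>Omega N. pmf \<nu> \<eta> * P t f \<eta>) = (\<Sum>\<eta>\<in>Omega N. pmf \<nu> \<eta> * f \<eta>)"
proof -
  have "(\<Sum>\<eta>\<in>Omega N. pmf \<nu> \<eta> * P t f \<eta>) = (\<Sum>\<eta>\<in>Omega N. \<Sum>\<xi>\<in>Omega N. pmf \<nu> \<eta> * p t \<eta> \<xi> * f \<xi>)"
    by (intro sum.cong) (auto simp: expectation_p sum_distrib_left mult_ac)
  also have "\<dots> = (\<Sum>\<xi>\<in>Omega N. (\<Sum>\<eta>\<in>Omega N. pmf \<nu> \<eta> * p t \<eta> \<xi>) * f \<xi>)"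
    by (subst sum.swap) (simp add: sum_distrib_right)
  also have "\<dots> = (\<Sum>\<xi>\<in>Omega N. pmf \<nu> \<xi> * f \<xi>)"
    using assms by (intro sum.cong) (auto simp: sep_stationary_def)
  finally show ?thesis .
qed

lemma stationary_sum: "stationary \<nu> \<Longrightarrow> (\<Sum>\<eta>\<in>Omega N. pmf \<nu> \<eta>) = 1"
  by (intro sum_pmf_eq_1) (auto simp: sep_stationary_def)

lemma stationary_close:
  assumes \<nu>: "stationary \<nu>" and t: "0 \<le> t" and f: "\<And>\<zeta>. \<zeta> \<in> Omega N \<Longrightarrow> \<bar>f \<zeta>\<bar> \<le> B" and \<eta>: "\<eta> \<in> Omega N"
  shows "\<bar>P t f \<eta> - (\<Sum>\<xi>\<in>Omega N. pmf \<nu> \<xi> * f \<xi>)\<bar> \<le> 4 * B * K * real N ^ 3 * exp (- \<kappa> * t)"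
proof -
  let ?c = "4 * B * K * real N ^ 3 * exp (- \<kappa> * t)"
  have eq: "P t f \<eta> - (\<Sum>\<xi>\<in>Omega N. pmf \<nu> \<xi> * f \<xi>) = (\<Sum>\<xi>\<in>Omega N. pmf \<nu> \<xi> * (P t f \<eta> - P t f \<xi>))"
    using stationary_expectation[OF \<nu> t, of f] stationary_sum[OF \<nu>]
    by (simp add: right_diff_distrib sum_subtractf flip: sum_distrib_right)
  have "\<bar>\<Sum>\<xi>\<in>Omega N. pmf \<nu> \<xi> * (P t f \<eta> - P t f \<xi>)\<bar> \<le> (\<Sum>\<xi>\<in>Omega N. pmf \<nu> \<xi> * ?c)"
  proof (rule order_trans[OF sum_abs sum_mono])
    fix \<xi> assume \<xi>: "\<xi> \<in> Omega N"
    show "\<bar>pmf \<nu> \<xi> * (P t f \<eta> - P t f \<xi>)\<bar> \<le> pmf \<nu> \<xi> * ?c"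
      unfolding abs_mult abs_of_nonneg[OF pmf_nonneg]
      by (intro mult_left_mono oscillation_decay f t \<eta> \<xi> pmf_nonneg)
  qed
  also have "\<dots> = (\<Sum>\<xi>\<in>Omega N. pmf \<nu> \<xi>) * ?c"
    by (rule sum_distrib_right[symmetric])
  also have "\<dots> = ?c"
    by (subst stationary_sum[OF \<nu>]) (rule mult_1)
  finally show ?thesis unfolding eq .
qed

lemma stationary_limit:
  assumes \<nu>: "stationary \<nu>" and \<eta>: "\<eta> \<in> Omega N"
  shows "(\<lambda>n. P (real n) f \<eta>) \<longlonglongrightarrow> (\<Sum>\<xi>\<in>Omega N. pmf \<nu> \<xi> * f \<xi>)"
proof -
  obtain B where B: "\<And>\<zeta>. \<zeta> \<in> Omega N \<Longrightarrow> \<bar>f \<zeta>\<bar> \<le> B" by (rule bounded_on_Omega[of f]) blast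
  have "(\<lambda>n. P (real n) f \<eta> - (\<Sum>\<xi>\<in>Omega N. pmf \<nu> \<xi> * f \<xi>)) \<longlonglongrightarrow> 0"
  proof (rule Lim_null_comparison[OF always_eventually[OF allI] exp_decay_tendsto])
    fix n
    show "norm (P (real n) f \<eta> - (\<Sum>\<xi>\<in>Omega N. pmf \<nu> \<xi> * f \<xi>)) \<le> 4 * B * K * real N ^ 3 * exp (- \<kappa> * real n)"
      unfolding real_norm_def by (rule stationary_close[OF \<nu> _ _ \<eta>]) (use B in auto)
  qed
  thus ?thesis using LIM_zero_iff by blast
qed

lemma stationary_unique:
  assumes \<nu>: "stationary \<nu>" and \<nu>': "stationary \<nu>'"
  shows "\<nu> = \<nu>'"
proof (rule pmf_eqI)
  fix \<xi>
  show "pmf \<nu> \<xi> = pmf \<nu>' \<xi>"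
  proof (cases "\<xi> \<in> Omega N")
    case True
    have *: "(\<Sum>\<zeta>\<in>Omega N. pmf \<rho> \<zeta> * indicator {\<xi>} \<zeta>) = pmf \<rho> \<xi>" for \<rho>
      using True indicator_expansion[of \<xi> "pmf \<rho>"] by (simp add: indicator_def eq_commute)
    show ?thesis
      using LIMSEQ_unique[OF stationary_limit[OF \<nu> empty_in_Omega] stationary_limit[OF \<nu>' empty_in_Omega],
          of "indicator {\<xi>}"] by (simp only: *)
  next
    case False
    hence "\<xi> \<notin> set_pmf \<nu>" "\<xi> \<notin> set_pmf \<nu>'"
      using \<nu> \<nu>' by (auto simp: sep_stationary_def)
    thus ?thesis by (simp add: set_pmf_iff)
  qed
qed

lemma mu_stationary: "stationary \<mu>"
  unfolding sep_mu_def using stationary_exists stationary_unique by (metis theI)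

text \<open>The total variation distance is attained on one event, and its indicator is a function bounded by
  1.\<close>

lemma tv_upper:
  assumes \<eta>: "\<eta> \<in> Omega N" and t: "0 \<le> t"
  shows "tv_dist N (p t \<eta>) (pmf \<mu>) \<le> 4 * K * real N ^ 3 * exp (- \<kappa> * t)"
proof -
  let ?S = "{\<xi> \<in> Omega N. pmf \<mu> \<xi> < p t \<eta> \<xi>}"
  have S: "(\<Sum>\<xi>\<in>Omega N. r \<xi> * indicator ?S \<xi>) = (\<Sum>\<xi>\<in>?S. r \<xi>)" for r :: "config \<Rightarrow> real"
    by (intro sum.mono_neutral_cong_right) auto
  have "tv_dist N (p t \<eta>) (pmf \<mu>) = (\<Sum>\<xi>\<in>?S. p t \<eta> \<xi> - pmf \<mu> \<xi>)"
    by (rule tv_dist_positive_part) (simp add: p_sum \<eta> stationary_sum mu_stationary)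
  also have "\<dots> = P t (indicator ?S) \<eta> - (\<Sum>\<xi>\<in>Omega N. pmf \<mu> \<xi> * indicator ?S \<xi>)"
    unfolding expectation_p[OF \<eta>] S by (simp add: sum_subtractf)
  also have "\<dots> \<le> 4 * K * real N ^ 3 * exp (- \<kappa> * t)"
    using stationary_close[OF mu_stationary t _ \<eta>, of "indicator ?S" 1] by (force simp: indicator_def)
  finally show ?thesis .
qed

text \<open>Evolved from the full and from the empty configuration, the observable with coefficients \<open>\<phi>\<close> has
  means at distance at least \<open>exp (- \<theta> t) s\<close>. Its stationary mean is therefore at distance at least
  half of that from one of the two, while the variance is at most \<open>N / 2\<close> both at time \<open>t\<close>
  and, passing to the limit, in equilibrium.\<close>

lemma tv_lower:
  assumes t: "0 \<le> t" and \<theta>: "\<theta> \<le> total_rate"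
    and sub: "\<And>x. x \<in> {1..N} \<Longrightarrow> - (\<theta> * \<phi> x) \<le> walk \<phi> x"
    and \<phi>: "\<And>x. x \<in> {1..N} \<Longrightarrow> \<bar>\<phi> x\<bar> \<le> 1" and s: "0 < s" "s \<le> (\<Sum>x = 1..N. \<phi> x)"
  shows "\<exists>\<eta>\<in>Omega N. 1 - 8 * real N / s\<^sup>2 * exp (2 * \<theta> * t) \<le> tv_dist N (p t \<eta>) (pmf \<mu>)"
proof -
  let ?F = "lin 0 \<phi>" and ?e = "empty_config N" and ?f = "full_config N"
  define d where "d = exp (- \<theta> * t) * s / 2"
  define V where "V = real N / 2"
  define b where "b = (\<Sum>\<xi>\<in>Omega N. pmf \<mu> \<xi> * ?F \<xi>)"
  have d: "0 < d" using s by (simp add: d_def)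
  have "grad_ge ?F \<phi>"
    unfolding grad_ge_def by (auto simp: lin_upd simp del: One_nat_def)
  from gradient_total[OF gradient_decay[OF this sub \<theta> t] full_in_Omega]
  have "(\<Sum>x = 1..N. exp (- \<theta> * t) * \<phi> x * real (?f x)) \<le> P t ?F ?f - P t ?F ?e" .
  moreover have "(\<Sum>x = 1..N. exp (- \<theta> * t) * \<phi> x * real (?f x)) = exp (- \<theta> * t) * (\<Sum>x = 1..N. \<phi> x)"
    unfolding sum_distrib_left by (intro sum.cong) (auto simp: full_config_def)
  moreover have "exp (- \<theta> * t) * s \<le> exp (- \<theta> * t) * (\<Sum>x = 1..N. \<phi> x)"
    using s by (intro mult_left_mono) auto
  ultimately have "d \<le> \<bar>P t ?F ?f - b\<bar> \<or> d \<le> \<bar>P t ?F ?e - b\<bar>"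
    unfolding d_def by linarith
  then obtain \<eta> where \<eta>: "\<eta> \<in> Omega N" and far: "d \<le> \<bar>P t ?F \<eta> - b\<bar>"
    using full_in_Omega empty_in_Omega by blast
  have "(\<Sum>x = 1..N. (\<phi> x)\<^sup>2) \<le> (\<Sum>x = 1..N. 1)"
    by (intro sum_mono) (simp add: \<phi> abs_square_le_1)
  hence var: "P r (\<lambda>\<zeta>. (?F \<zeta>)\<^sup>2) \<eta> - (P r ?F \<eta>)\<^sup>2 \<le> V" if "0 \<le> r" for r
    using variance_lin[OF \<eta> that, of 0 \<phi>] by (simp add: V_def)
  have "(\<Sum>\<xi>\<in>Omega N. pmf \<mu> \<xi> * (?F \<xi>)\<^sup>2) - b\<^sup>2 \<le> V"
    unfolding b_def
    by (rule LIMSEQ_le_const2[OF tendsto_diff[OF stationary_limit[OF mu_stationary \<eta>]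
      tendsto_power[OF stationary_limit[OF mu_stationary \<eta>]]]]) (use var in auto)
  hence "1 - 4 * V / d\<^sup>2 \<le> tv_dist N (p t \<eta>) (pmf \<mu>)"
    by (intro tv_dist_second_moment[where F = ?F and a = "P t ?F \<eta>" and b = b])
      (use \<eta> t d far var[OF t] in \<open>auto simp: p_nonneg p_sum stationary_sum mu_stationary b_def expectation_p\<close>)
  moreover have "4 * V / d\<^sup>2 = 8 * real N / s\<^sup>2 * exp (2 * \<theta> * t)"
    using s by (simp add: V_def d_def power2_eq_square exp_minus field_simps flip: exp_add)
  ultimately show ?thesis using \<eta> by auto
qed

end

section \<open>The half-wave test function\<close>

lemma one_minus_cos_le: "1 - cos x \<le> x\<^sup>2 / (2 :: real)"
proof -
  have "1 - cos x = 2 * (sin (x / 2))\<^sup>2"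
    using cos_double_sin[of "x / 2"] by simp
  also have "(sin (x / 2))\<^sup>2 \<le> (x / 2)\<^sup>2"
    unfolding abs_le_square_iff[symmetric] by (rule abs_sin_x_le_abs_x)
  finally show ?thesis by (simp add: power2_eq_square)
qed

lemma sine_recurrence: "sin (y + \<theta>) + sin (y - \<theta>) = 2 * cos \<theta> * sin (y :: real)"
  by (simp add: sin_add sin_diff)

text \<open>The second difference of the sine is a multiple of the sine, so the sum telescopes.\<close>

lemma sum_sines: "2 * (1 - cos \<theta>) * (\<Sum>j\<le>k. sin (real j * \<theta>)) = sin \<theta> + sin (real k * \<theta>) - sin (real (Suc k) * \<theta>)"
proof (induction k)
  case (Suc k)
  have e: "real (Suc (Suc k)) * \<theta> = real (Suc k) * \<theta> + \<theta>" "real k * \<theta> = real (Suc k) * \<theta> - \<theta>"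
    by (simp_all add: algebra_simps)
  have "2 * (1 - cos \<theta>) * (\<Sum>j\<le>Suc k. sin (real j * \<theta>))
     = 2 * (1 - cos \<theta>) * (\<Sum>j\<le>k. sin (real j * \<theta>)) + 2 * (1 - cos \<theta>) * sin (real (Suc k) * \<theta>)"
    by (simp only: sum.atMost_Suc distrib_left)
  also have "\<dots> = sin \<theta> + sin (real k * \<theta>) - sin (real (Suc k) * \<theta>)
      + (2 * sin (real (Suc k) * \<theta>) - (sin (real (Suc (Suc k)) * \<theta>) + sin (real k * \<theta>)))"
    unfolding Suc.IH e sine_recurrence by (simp add: algebra_simps)
  finally show ?case by simp
qed simp

text \<open>The sum equals the cotangent of \<open>\<theta> / 2\<close> for \<open>\<theta> = pi / n\<close>. Bounding the cosine of \<open>\<theta> / 2\<close> below by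
  \<open>1/2\<close> loses a factor 2, which is harmless because only the order of growth matters.\<close>

lemma sum_half_wave:
  assumes "2 \<le> n"
  shows "real n / pi \<le> (\<Sum>j\<le>n. sin (real j * (pi / real n)))"
proof -
  define \<theta> where "\<theta> = pi / real n"
  have \<theta>: "0 < \<theta>" "\<theta> \<le> pi / 2"
  proof -
    show "0 < \<theta>" using assms by (simp add: \<theta>_def)
    show "\<theta> \<le> pi / 2" unfolding \<theta>_def using assms by (intro divide_left_mono) auto
  qed
  define s c where "s = sin (\<theta> / 2)" and "c = cos (\<theta> / 2)"
  have s: "0 < s" "s \<le> \<theta> / 2"
    using \<theta> sin_gt_zero[of "\<theta> / 2"] sin_x_le_x[of "\<theta> / 2"] pi_gt_zero by (auto simp: s_def)
  have c: "1 / 2 \<le> c"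
    unfolding c_def cos_60[symmetric] using \<theta> by (intro cos_monotone_0_pi_le) auto
  have "2 * (1 - cos \<theta>) * (\<Sum>j\<le>n. sin (real j * \<theta>)) = sin \<theta> + sin pi - sin (pi + \<theta>)"
    unfolding sum_sines using assms by (simp add: \<theta>_def field_simps)
  hence "2 * (1 - cos \<theta>) * (\<Sum>j\<le>n. sin (real j * \<theta>)) = 2 * sin \<theta>" by simp
  moreover have "1 - cos \<theta> = 2 * s\<^sup>2" using cos_double_sin[of "\<theta> / 2"] by (simp add: s_def)
  moreover have "sin \<theta> = 2 * s * c" using sin_double[of "\<theta> / 2"] by (simp add: s_def c_def)
  ultimately have "s * (\<Sum>j\<le>n. sin (real j * \<theta>)) = c"
    using s by (simp add: power2_eq_square)
  hence sum: "(\<Sum>j\<le>n. sin (real j * \<theta>)) = c / s" using s by (simp add: field_simps)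
  have "s * 1 \<le> c * \<theta>"
  proof -
    have "1 / 2 * \<theta> \<le> c * \<theta>" using c \<theta> by (intro mult_right_mono) auto
    thus ?thesis using s by linarith
  qed
  hence "1 / \<theta> \<le> c / s" using s \<theta> by (simp add: field_simps)
  thus ?thesis unfolding \<theta>_def[symmetric] sum by (simp add: \<theta>_def)
qed

context ergodic_ssep begin

text \<open>The sine half-wave vanishing at sites 1 and \<open>N\<close> is the principal eigenfunction of the walk that is killed
  instantly at both ends. Finite killing rates act on the value at the end sites, which is 0,
  and inflow from the neighbouring site is nonnegative: it is a subsolution with the same rate \<open>1 - cos \<theta>\<close> for every choice of boundary parameters. This is why the constant \<open>1 / pi\<^sup>2\<close> does
  not depend on them.\<close>

lemma tv_lower_half_wave:
  assumes N: "5 \<le> N" and t: "0 \<le> t"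
  shows "\<exists>\<eta>\<in>Omega N. 1 - 8 * pi\<^sup>2 * real N / (real N - 1)\<^sup>2 * exp (pi\<^sup>2 / (real N - 1)\<^sup>2 * t)
      \<le> tv_dist N (p t \<eta>) (pmf \<mu>)"
proof -
  define n where "n = N - 1"
  have n: "real n = real N - 1" "2 \<le> n" "N = n + 1" using N by (auto simp: n_def)
  define \<theta> where "\<theta> = pi / real n"
  define \<phi> where "\<phi> x = sin ((real x - 1) * \<theta>)" for x
  have \<phi>_nonneg: "0 \<le> \<phi> x" if x: "x \<in> {1..N}" for x
  proof -
    have "(real x - 1) * pi \<le> real n * pi" using x n(3) by (intro mult_right_mono) auto
    hence "(real x - 1) * pi / real n \<le> pi" using n(2) by (simp add: pos_divide_le_eq mult.commute)
    hence "(real x - 1) * \<theta> \<le> pi" by (simp add: \<theta>_def)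
    thus ?thesis unfolding \<phi>_def using x by (intro sin_ge_zero mult_nonneg_nonneg) (auto simp: \<theta>_def)
  qed
  have sub: "- ((1 - cos \<theta>) * \<phi> x) \<le> walk \<phi> x" if x: "x \<in> {1..N}" for x
  proof -
    consider "x = 1" | "1 < x" "x < N" | "x = N" "1 < x" using x N by force
    thus ?thesis
    proof cases
      case 1
      have "\<phi> x = 0" using 1 by (simp add: \<phi>_def)
      moreover have "0 \<le> \<phi> (x + 1)" using 1 N by (intro \<phi>_nonneg) auto
      ultimately show ?thesis unfolding walk_steps[OF x] using 1 N by simp
    next
      case 2
      have "\<phi> (x + 1) + \<phi> (x - 1) = 2 * cos \<theta> * \<phi> x"
        using sine_recurrence[of "(real x - 1) * \<theta>" \<theta>] 2 by (simp add: \<phi>_def of_nat_diff algebra_simps)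
      thus ?thesis unfolding walk_steps[OF x] using 2 by (simp add: field_simps)
    next
      case 3
      have "\<phi> x = 0" using 3 n(2,3) by (simp add: \<phi>_def \<theta>_def)
      moreover have "0 \<le> \<phi> (x - 1)" using 3 by (intro \<phi>_nonneg) auto
      ultimately show ?thesis unfolding walk_steps[OF x] using 3 by simp
    qed
  qed
  have le_rate: "1 - cos \<theta> \<le> total_rate"
  proof -
    have "4 \<le> real (N - 1)" using N by linarith
    hence "2 \<le> total_rate" using nonneg unfolding total_rate_def by linarith
    thus ?thesis using cos_ge_minus_one[of \<theta>] by linarith
  qed
  have "(\<Sum>x = 1..N. \<phi> x) = (\<Sum>j\<le>n. sin (real j * \<theta>))"
    unfolding n(3) by (intro sum.reindex_bij_witness[of _ "\<lambda>j. j + 1" "\<lambda>x. x - 1"]) (auto simp: \<phi>_def of_nat_diff)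
  with sum_half_wave[OF n(2)] have S: "real n / pi \<le> (\<Sum>x = 1..N. \<phi> x)" by (simp add: \<theta>_def)
  obtain \<eta> where \<eta>: "\<eta> \<in> Omega N"
    and tv: "1 - 8 * real N / (real n / pi)\<^sup>2 * exp (2 * (1 - cos \<theta>) * t) \<le> tv_dist N (p t \<eta>) (pmf \<mu>)"
    using tv_lower[OF t le_rate sub _ _ S] n(2) by (auto simp: \<phi>_def)
  have "2 * (1 - cos \<theta>) * t \<le> \<theta>\<^sup>2 * t"
    using one_minus_cos_le[of \<theta>] t by (intro mult_right_mono) auto
  also have "\<theta>\<^sup>2 = pi\<^sup>2 / (real N - 1)\<^sup>2" by (simp add: \<theta>_def n(1) power_divide)
  finally have "8 * real N / (real n / pi)\<^sup>2 * exp (2 * (1 - cos \<theta>) * t)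
      \<le> 8 * real N / (real n / pi)\<^sup>2 * exp (pi\<^sup>2 / (real N - 1)\<^sup>2 * t)"
    by (intro mult_left_mono) auto
  moreover have "8 * real N / (real n / pi)\<^sup>2 = 8 * pi\<^sup>2 * real N / (real N - 1)\<^sup>2"
    by (simp add: n(1) power_divide)
  ultimately show ?thesis using \<eta> tv by (intro bexI[of _ \<eta>]) auto
qed

section \<open>Mixing times\<close>

lemma tmix_ge:
  assumes "\<And>t. 0 \<le> t \<Longrightarrow> t < T \<Longrightarrow> \<exists>\<eta>\<in>Omega N. \<epsilon> \<le> tv_dist N (p t \<eta>) (pmf \<mu>)"
  shows "ereal T \<le> sep_tmix (1/2) \<alpha> \<beta> \<gamma> \<delta> N \<epsilon>"
  unfolding sep_tmix_def
proof (rule Inf_greatest, clarify)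
  fix t assume t: "0 \<le> t" and less: "Max ((\<lambda>\<eta>. tv_dist N (p t \<eta>) (pmf \<mu>)) ` Omega N) < \<epsilon>"
  have "tv_dist N (p t \<eta>) (pmf \<mu>) < \<epsilon>" if "\<eta> \<in> Omega N" for \<eta>
    using that by (intro le_less_trans[OF Max_ge less]) auto
  with assms[OF t] have "\<not> t < T" by force
  thus "ereal T \<le> ereal t" by simp
qed

lemma tmix_le:
  assumes "0 \<le> t" "\<And>\<eta>. \<eta> \<in> Omega N \<Longrightarrow> tv_dist N (p t \<eta>) (pmf \<mu>) < \<epsilon>"
  shows "sep_tmix (1/2) \<alpha> \<beta> \<gamma> \<delta> N \<epsilon> \<le> ereal t"
proof -
  have ne: "Omega N \<noteq> {}" using empty_in_Omega by blast
  have "Max ((\<lambda>\<eta>. tv_dist N (p t \<eta>) (pmf \<mu>)) ` Omega N) < \<epsilon>"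
    using assms(2) ne by (subst Max_less_iff) auto
  thus ?thesis unfolding sep_tmix_def using assms(1) by (intro Inf_lower) auto
qed

lemma tmix_lower:
  assumes N: "5 \<le> N" and c: "0 \<le> c" and small: "8 * pi\<^sup>2 * real N / (real N - 1)\<^sup>2
      * exp (pi\<^sup>2 * c * (real N ^ 2 / (real N - 1)\<^sup>2) * ln (real N)) \<le> 1 - \<epsilon>"
  shows "ereal (c * (real N ^ 2 * ln (real N))) \<le> sep_tmix (1/2) \<alpha> \<beta> \<gamma> \<delta> N \<epsilon>"
proof (rule tmix_ge)
  fix t assume t: "0 \<le> t" "t < c * (real N ^ 2 * ln (real N))"
  have "pi\<^sup>2 / (real N - 1)\<^sup>2 * t \<le> pi\<^sup>2 / (real N - 1)\<^sup>2 * (c * (real N ^ 2 * ln (real N)))"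
    using t by (intro mult_left_mono) auto
  hence "8 * pi\<^sup>2 * real N / (real N - 1)\<^sup>2 * exp (pi\<^sup>2 / (real N - 1)\<^sup>2 * t)
    \<le> 8 * pi\<^sup>2 * real N / (real N - 1)\<^sup>2 * exp (pi\<^sup>2 * c * (real N ^ 2 / (real N - 1)\<^sup>2) * ln (real N))"
    by (intro mult_left_mono) (auto simp: field_simps)
  with small tv_lower_half_wave[OF N t(1)]
  show "\<exists>\<eta>\<in>Omega N. \<epsilon> \<le> tv_dist N (p t \<eta>) (pmf \<mu>)" by force
qed

text \<open>The constant 8 makes \<open>exp (- \<kappa> t)\<close> equal to the inverse of \<open>N\<^sup>4\<close>, one power more than the
  prefactor \<open>N\<^sup>3\<close> of the total variation bound.\<close>

lemma tmix_upper:
  assumes "4 * K / real N < \<epsilon>"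
  shows "sep_tmix (1/2) \<alpha> \<beta> \<gamma> \<delta> N \<epsilon> \<le> ereal (8 * K * (real N ^ 2 * ln (real N)))"
proof (rule tmix_le)
  let ?t = "8 * K * (real N ^ 2 * ln (real N))"
  have N: "0 < real N" "1 \<le> real N" using N2 by auto
  show t: "0 \<le> ?t" using K_ge_1 N by simp
  have "\<kappa> * ?t = 4 * ln (real N)"
    using K_ge_1 N by (simp add: \<kappa>_def field_simps)
  hence "exp (- \<kappa> * ?t) = exp (- (4 * ln (real N)))" by (simp only: mult_minus_left)
  also have "\<dots> = inverse (exp (ln (real N)) ^ 4)"
    using exp_of_nat_mult[of 4 "ln (real N)"] by (simp add: exp_minus)
  also have "\<dots> = 1 / real N ^ 4" using N by (simp add: inverse_eq_divide)
  finally have "exp (- \<kappa> * ?t) = 1 / real N ^ 4" .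
  hence "4 * K * real N ^ 3 * exp (- \<kappa> * ?t) = 4 * K / real N"
    using N by (simp add: power_numeral_reduce)
  with assms tv_upper[OF _ t] show "tv_dist N (p ?t \<eta>) (pmf \<mu>) < \<epsilon>" if "\<eta> \<in> Omega N" for \<eta>
    using that by force
qed

end

text \<open>The exponential grows like \<open>N\<close> to the power \<open>k\<close>, and the prefactor decays like the inverse of
  \<open>N\<close>; \<open>k < 1\<close> is the threshold that fixes the constant in the lower bound.\<close>

lemma lower_bound_vanishes:
  assumes "0 < k" "k < 1"
  shows "(\<lambda>N. 8 * pi\<^sup>2 * real N / (real N - 1)\<^sup>2 * exp (k * (real N ^ 2 / (real N - 1)\<^sup>2) * ln (real N))) \<longlonglongrightarrow> 0"
  using assms by real_asymp

theorem theorem1p1: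
  fixes \<alpha> \<beta> \<gamma> \<delta> :: real
  assumes "\<alpha> \<ge> 0" "\<beta> \<ge> 0" "\<gamma> \<ge> 0" "\<delta> \<ge> 0"
    and "Max {\<alpha>, \<beta>, \<gamma>, \<delta>} > 0"
  shows "\<exists>C::real. \<forall>\<epsilon>. 0 < \<epsilon> \<and> \<epsilon> < 1 \<longrightarrow>
    (let r = (\<lambda>N::nat. sep_tmix (1 / 2) \<alpha> \<beta> \<gamma> \<delta> N \<epsilon> / ereal (real N ^ 2 * ln (real N))) in
      ereal (1 / pi ^ 2) \<le> liminf r \<and> liminf r \<le> limsup r \<and> limsup r \<le> ereal C)"
proof -
  define K where "K = relax_const (\<alpha> + \<gamma>) (\<beta> + \<delta>)"
  have "0 < \<alpha> \<or> 0 < \<beta> \<or> 0 < \<gamma> \<or> 0 < \<delta>" using assms(5) by (auto simp: max_def split: if_splits)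
  hence "0 < max (\<alpha> + \<gamma>) (\<beta> + \<delta>)" using assms(1-4) by (auto simp: less_max_iff_disj)
  hence erg: "ergodic_ssep \<alpha> \<beta> \<gamma> \<delta> N" if "2 \<le> N" for N
    using assms that by unfold_locales auto
  have scale_pos: "0 < real N ^ 2 * ln (real N)" if "2 \<le> N" for N
    using that by simp
  have cancel: "ereal (a * b) / ereal b = ereal a" if "0 < b" for a b :: real
    using that by simp
  show ?thesis
  proof (intro exI[of _ "8 * K"] allI impI)
    fix \<epsilon> :: real assume \<epsilon>: "0 < \<epsilon> \<and> \<epsilon> < 1"
    define r where "r = (\<lambda>N::nat. sep_tmix (1/2) \<alpha> \<beta> \<gamma> \<delta> N \<epsilon> / ereal (real N ^ 2 * ln (real N)))"
    have upper: "limsup r \<le> ereal (8 * K)"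
    proof (rule Limsup_bounded)
      have "(\<lambda>N. 4 * K / real N) \<longlonglongrightarrow> 0" by real_asymp
      hence "\<forall>\<^sub>F N in sequentially. 4 * K / real N < \<epsilon>"
        using \<epsilon> by (intro order_tendstoD) auto
      thus "\<forall>\<^sub>F N in sequentially. r N \<le> ereal (8 * K)"
        using eventually_ge_at_top[of 2]
      proof eventually_elim
        case (elim N)
        interpret ergodic_ssep \<alpha> \<beta> \<gamma> \<delta> N using erg elim by simp
        have "r N \<le> ereal (8 * K * (real N ^ 2 * ln (real N))) / ereal (real N ^ 2 * ln (real N))"
          unfolding r_def using scale_pos[OF elim(2)] tmix_upper elim(1)
          by (intro ereal_divide_right_mono) (auto simp: K_def)
        also have "\<dots> = ereal (8 * K)" by (rule cancel[OF scale_pos[OF elim(2)]])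
        finally show ?case .
      qed
    qed
    have lower: "ereal (1 / pi ^ 2) \<le> liminf r"
      unfolding le_Liminf_iff
    proof (intro allI impI)
      \<comment> \<open>For \<open>c < 1 / pi\<^sup>2\<close> the mean separation at time \<open>c N\<^sup>2 ln N\<close> still exceeds the standard deviation by a power of \<open>N\<close>.\<close>
      fix y :: ereal assume "y < ereal (1 / pi ^ 2)"
      hence "max y 0 < ereal (1 / pi ^ 2)" by simp
      then obtain c where c: "max y 0 < ereal c" "ereal c < ereal (1 / pi ^ 2)"
        using ereal_dense2 by blast
      have c0: "0 < c" using c(1) by (simp add: max_less_iff_conj)
      have "pi\<^sup>2 * c < 1" using c(2) by (simp add: field_simps)
      with c0 have "(\<lambda>N. 8 * pi\<^sup>2 * real N / (real N - 1)\<^sup>2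
          * exp (pi\<^sup>2 * c * (real N ^ 2 / (real N - 1)\<^sup>2) * ln (real N))) \<longlonglongrightarrow> 0"
        by (intro lower_bound_vanishes) auto
      hence "\<forall>\<^sub>F N in sequentially. 8 * pi\<^sup>2 * real N / (real N - 1)\<^sup>2
          * exp (pi\<^sup>2 * c * (real N ^ 2 / (real N - 1)\<^sup>2) * ln (real N)) < 1 - \<epsilon>"
        using \<epsilon> by (intro order_tendstoD) auto
      thus "\<forall>\<^sub>F N in sequentially. y < r N"
        using eventually_ge_at_top[of 5]
      proof eventually_elim
        case (elim N)
        have N2: "2 \<le> N" using elim by simp
        interpret ergodic_ssep \<alpha> \<beta> \<gamma> \<delta> N using erg N2 by simp
        have "y < ereal c" using c(1) by simp
        also have "\<dots> = ereal (c * (real N ^ 2 * ln (real N))) / ereal (real N ^ 2 * ln (real N))"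
          by (rule cancel[OF scale_pos[OF N2], symmetric])
        also have "\<dots> \<le> r N"
          unfolding r_def using scale_pos[OF N2] tmix_lower[OF elim(2)] c0 elim(1)
          by (intro ereal_divide_right_mono) auto
        finally show ?case .
      qed
    qed
    have "liminf r \<le> limsup r" by (rule Liminf_le_Limsup) simp
    with lower upper show "let r = (\<lambda>N::nat. sep_tmix (1 / 2) \<alpha> \<beta> \<gamma> \<delta> N \<epsilon> / ereal (real N ^ 2 * ln (real N))) in
      ereal (1 / pi ^ 2) \<le> liminf r \<and> liminf r \<le> limsup r \<and> limsup r \<le> ereal (8 * K)"
      by (simp only: Let_def r_def)
  qed
qed

end
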